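(* Let $L$ be a row-Latin array of order $n$. If $L$ has at least $\frac14(5-\sqrt5)n^2$ distinct symbols, then $L$ has a transversal. Consequently $\ell_r(n)\le\big\lceil\frac14(5-\sqrt5)n^2\big\rceil$ for every integer $n>1$.
   Context: An array of order $n$ is an $n\times n$ array with a symbol in each cell; an entry is a triple $(i,j,A_{ij})$. An array is row-Latin if no symbol appears more than once in any row. A transversal of an $n\times n$ array is a set of $n$ entries, no two agreeing in row, column, or symbol. $\ell_r(n)$ is the least positive integer such that $\ell_r(n)\ge n$ and every $n\times n$ row-Latin array with at least $\ell_r(n)$ distinct symbols contains a transversal. *)

theory Defs
  imports Complex_Main
begin

definition row_latin :: "nat \<Rightarrow> (nat \<Rightarrow> nat \<Rightarrow> 'a) \<Rightarrow> bool" where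
  "row_latin n A \<longleftrightarrow> (\<forall>i<n. inj_on (A i) {..<n})"

definition symbols :: "nat \<Rightarrow> (nat \<Rightarrow> nat \<Rightarrow> 'a) \<Rightarrow> 'a set" where
  "symbols n A = {A i j | i j. i < n \<and> j < n}"

definition is_transversal :: "nat \<Rightarrow> (nat \<Rightarrow> nat \<Rightarrow> 'a) \<Rightarrow> (nat \<times> nat) set \<Rightarrow> bool" where
  "is_transversal n A T \<longleftrightarrow> T \<subseteq> {..<n} \<times> {..<n} \<and> card T = n \<and>
     inj_on fst T \<and> inj_on snd T \<and> inj_on (\<lambda>(i, j). A i j) T"

definition has_transversal :: "nat \<Rightarrow> (nat \<Rightarrow> nat \<Rightarrow> 'a) \<Rightarrow> bool" where
  "has_transversal n A \<longleftrightarrow> (\<exists>T. is_transversal n A T)"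

text \<open>l_r(n); symbols taken from nat, which is no loss of generality (relabelling).\<close>
definition l_r :: "nat \<Rightarrow> nat" where
  "l_r n = (LEAST l. 0 < l \<and> n \<le> l \<and>
     (\<forall>A :: nat \<Rightarrow> nat \<Rightarrow> nat. row_latin n A \<and> l \<le> card (symbols n A) \<longrightarrow> has_transversal n A))"

end

(*
Let c = (5 - sqrt 5)/4, so that 1 - c = a - a^2/2 for a = 2c - 1, and take a smallest array with at
least c n^2 symbols and no transversal.  Call a symbol exclusive to a column if it occurs in no other
column.  Deleting the row and the column of a singleton leaves an array without a transversal, so
more than c(2n - 1) symbols disappear; hence the column has more than a n exclusive symbols.

Suppose T is a partial transversal and, by exchanging a few cells, one obtains partial transversals
of the same size that miss, in turn, mu different rows together with mu different columns.  As none
of these can be enlarged, essentially every missed row and column form n pairs of cells each of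
which contributes at most one symbol outside T; so there are at most n^2 - mu n + mu^2/2 + O(mu)
symbols, which is too few as soon as mu > a n.

If some T of size n - 1 misses the column of a singleton, the exclusive symbols of that column
provide the exchanges.  Otherwise, by Hall's theorem, any partial transversal covering all columns
without singletons extends by exclusive symbols to a transversal; so a largest T in those columns
misses one of them and more than a n rows, and row-Latinness makes each missed row yield a
new exchange.
*)

theory Submission
  imports Defs
begin

section \<open>Hall's theorem\<close>

text \<open>Halmos-Vaughan induction on \<open>card A\<close>. If some nonempty proper subset
  \<open>S\<close> is tight, \<open>S\<close> and \<open>A - S\<close> are matched separately, the
  latter outside the neighbours of \<open>S\<close>. Otherwise every nonempty proper subset has a
  spare neighbour, so any single pair can be fixed and its right end removed.\<close>

theorem hall:
  assumes "finite A" "\<forall>a\<in>A. finite (N a)"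
    and "\<forall>S\<subseteq>A. card S \<le> card (\<Union>(N ` S))"
  shows "\<exists>f. inj_on f A \<and> (\<forall>a\<in>A. f a \<in> N a)"
  using assms
proof (induction "card A" arbitrary: A N rule: less_induct)
  case less
  note fin = less.prems(1) and finN = less.prems(2) and hc = less.prems(3)
  show ?case
  proof (cases "\<exists>S. S \<subset> A \<and> S \<noteq> {} \<and> card (\<Union>(N ` S)) \<le> card S")
    case True
    then obtain S where S: "S \<subset> A" "S \<noteq> {}" "card (\<Union>(N ` S)) \<le> card S" by blast
    let ?U = "\<Union>(N ` S)"
    have finS: "finite S" using S fin finite_subset by blast
    have "card S < card A" using S fin by (simp add: psubset_card_mono)
    then obtain f where f: "inj_on f S" "\<forall>a\<in>S. f a \<in> N a"
    proof -
      have "\<forall>a\<in>S. finite (N a)" "\<forall>X\<subseteq>S. card X \<le> card (\<Union>(N ` X))"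
        using finN hc S(1) by auto
      then show ?thesis using less.hyps[of S N] finS \<open>card S < card A\<close> that by blast
    qed
    have lt: "card (A - S) < card A"
      using S fin by (intro psubset_card_mono) auto
    have "card X \<le> card (\<Union>((\<lambda>a. N a - ?U) ` X))" if X: "X \<subseteq> A - S" for X
    proof -
      have "card X + card S = card (X \<union> S)"
      proof -
        have "X \<inter> S = {}" "finite X" using X fin by (auto intro: finite_subset)
        then show ?thesis using finS by (simp add: card_Un_disjoint)
      qed
      also have "\<dots> \<le> card (\<Union>(N ` (X \<union> S)))"
        using X S(1) by (intro hc[rule_format]) auto
      also have "\<Union>(N ` (X \<union> S)) = (\<Union>((\<lambda>a. N a - ?U) ` X)) \<union> ?U" by blast
      also have "card \<dots> \<le> card (\<Union>((\<lambda>a. N a - ?U) ` X)) + card ?U" by (rule card_Un_le)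
      finally show ?thesis using S(3) by linarith
    qed
    moreover have "finite (A - S)" "\<forall>a\<in>A - S. finite (N a - ?U)" using fin finN by auto
    ultimately obtain g where g: "inj_on g (A - S)" "\<forall>a\<in>A - S. g a \<in> N a - ?U"
      using less.hyps[OF lt, of "\<lambda>a. N a - ?U"] by blast
    let ?h = "\<lambda>a. if a \<in> S then f a else g a"
    have "inj_on ?h A"
    proof (rule inj_onI)
      fix x y assume "x \<in> A" "y \<in> A" "?h x = ?h y"
      moreover have "f u \<noteq> g v" if "u \<in> S" "v \<in> A - S" for u v using f(2) g(2) that by auto
      ultimately show "x = y"
        using inj_onD[OF f(1)] inj_onD[OF g(1)] by (metis DiffI)
    qed
    moreover have "\<forall>a\<in>A. ?h a \<in> N a" using f g by auto
    ultimately show ?thesis by blast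
  next
    case no_tight: False
    show ?thesis
    proof (cases "A = {}")
      case True
      then show ?thesis by auto
    next
      case nonempty: False
      then obtain a where a: "a \<in> A" by blast
      have "card {a} \<le> card (\<Union>(N ` {a}))" using hc a by blast
      then obtain b where b: "b \<in> N a" by fastforce
      have lt: "card (A - {a}) < card A" using card_Diff1_less[OF fin a] .
      have "card X \<le> card (\<Union>((\<lambda>x. N x - {b}) ` X))" if X: "X \<subseteq> A - {a}" for X
      proof (cases "X = {}")
        case False
        then have "card X < card (\<Union>(N ` X))"
        proof -
          have "X \<subset> A" using X a by blast
          then show ?thesis using no_tight False by (meson not_le)
        qed
        moreover have "\<Union>((\<lambda>x. N x - {b}) ` X) = \<Union>(N ` X) - {b}" by blast
        moreover have "card (\<Union>(N ` X)) - 1 \<le> card (\<Union>(N ` X) - {b})"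
          by (metis One_nat_def card_Diff_singleton_if diff_le_self order_refl)
        ultimately show ?thesis by simp
      qed simp
      moreover have "finite (A - {a})" "\<forall>x\<in>A - {a}. finite (N x - {b})" using fin finN by auto
      ultimately obtain g where g: "inj_on g (A - {a})" "\<forall>x\<in>A - {a}. g x \<in> N x - {b}"
        using less.hyps[OF lt, of "\<lambda>x. N x - {b}"] by blast
      have "inj_on (g(a := b)) A"
        using g unfolding inj_on_def by auto
      moreover have "\<forall>x\<in>A. (g(a := b)) x \<in> N x" using g b by auto
      ultimately show ?thesis by blast
    qed
  qed
qed

section \<open>Counting symbols\<close>

text \<open>Rows and columns come from arbitrary types, so that deleting a row and a column needs no
  relabelling. No size is imposed, since the proof works mostly with partial transversals.\<close>

definition rainbow :: "('r \<Rightarrow> 'k \<Rightarrow> 'a) \<Rightarrow> ('r \<times> 'k) set \<Rightarrow> bool" where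
  "rainbow A T \<longleftrightarrow> inj_on fst T \<and> inj_on snd T \<and> inj_on (case_prod A) T"

lemma rainbow_subset: "rainbow A T \<Longrightarrow> S \<subseteq> T \<Longrightarrow> rainbow A S"
  unfolding rainbow_def by (auto intro: inj_on_subset)

lemma rainbow_fstD: "rainbow A T \<Longrightarrow> (x, p) \<in> T \<Longrightarrow> (x, q) \<in> T \<Longrightarrow> p = q"
  unfolding rainbow_def by (auto dest: inj_onD[of fst T "(x, p)" "(x, q)"])

lemma rainbow_sndD: "rainbow A T \<Longrightarrow> (x, p) \<in> T \<Longrightarrow> (y, p) \<in> T \<Longrightarrow> x = y"
  unfolding rainbow_def by (auto dest: inj_onD[of snd T "(x, p)" "(y, p)"])

lemma rainbow_symD:
  "rainbow A T \<Longrightarrow> (x, p) \<in> T \<Longrightarrow> (y, q) \<in> T \<Longrightarrow> A x p = A y q \<Longrightarrow> x = y \<and> p = q"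
  unfolding rainbow_def by (auto dest: inj_onD[of "case_prod A" T "(x, p)" "(y, q)"])

lemma case_prod_imageI: "(x, p) \<in> S \<Longrightarrow> A x p \<in> case_prod A ` S"
  by force

lemma case_prod_imageE:
  assumes "v \<in> case_prod A ` S"
  obtains x p where "(x, p) \<in> S" "v = A x p"
  using assms by auto

lemma rainbow_insert:
  assumes "rainbow A T" "r \<notin> fst ` T" "m \<notin> snd ` T" "A r m \<notin> case_prod A ` T"
  shows "rainbow A (insert (r, m) T)"
proof -
  have "T - {(r, m)} = T" using assms(2) by force
  then show ?thesis using assms unfolding rainbow_def by simp
qed

text \<open>Removing \<open>(x, q)\<close> frees row \<open>x\<close> and column \<open>q\<close>,
  which are used again with the missed column \<open>m\<close> and the missed row \<open>r\<close>:
  one cell out, two in. For a partial transversal that cannot be enlarged this forces a conflict of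
  symbols; after deletion of another cell it gives an exchange that keeps the size.\<close>

lemma rainbow_swap:
  assumes "rainbow A T" "(x, q) \<in> T" "r \<notin> fst ` T" "m \<notin> snd ` T"
    and "A x m \<notin> case_prod A ` (T - {(x, q)})" "A r q \<notin> case_prod A ` (T - {(x, q)})"
    and "A x m \<noteq> A r q" "finite T"
  shows "rainbow A (insert (r, q) (insert (x, m) (T - {(x, q)})))"
    and "card (insert (r, q) (insert (x, m) (T - {(x, q)}))) = Suc (card T)"
proof -
  let ?T = "T - {(x, q)}"
  have 0: "rainbow A ?T" using assms(1) rainbow_subset by blast
  have x: "x \<notin> fst ` ?T" using rainbow_fstD[OF assms(1,2)] by fastforce
  have q: "q \<notin> snd ` ?T" using rainbow_sndD[OF assms(1)] assms(2) by fastforce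
  have rx: "r \<noteq> x" using assms(2,3) by force
  have mq: "m \<noteq> q" using assms(2,4) by force
  have r: "r \<notin> fst ` ?T" and m: "m \<notin> snd ` ?T" using assms(3,4) by blast+
  have 1: "rainbow A (insert (x, m) ?T)" using rainbow_insert[OF 0 x m assms(5)] .
  show "rainbow A (insert (r, q) (insert (x, m) ?T))"
    by (rule rainbow_insert[OF 1]) (use r q rx mq assms(6,7) in auto)
  have "card (insert (r, q) (insert (x, m) ?T)) = Suc (Suc (card ?T))"
  proof -
    have "(r, q) \<notin> insert (x, m) ?T" using r rx by force
    moreover have "(x, m) \<notin> ?T" using m by force
    moreover have "finite ?T" using assms(8) by simp
    ultimately show ?thesis by (metis card_insert_disjoint finite_insert)
  qed
  also have "Suc (card ?T) = card T" using card_Suc_Diff1[OF assms(8,2)] by simp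
  finally show "card (insert (r, q) (insert (x, m) ?T)) = Suc (card T)" .
qed

text \<open>The hypothesis \<open>conflict\<close> holds if the partial transversal \<open>M s\<close>, which misses row \<open>r s\<close> and
  column \<open>m s\<close>, cannot be enlarged: otherwise \<open>(x, m s)\<close> and \<open>(r s, q)\<close> could replace \<open>(x, q)\<close>.
  So one cell of each such pair can be discarded without losing a symbol.\<close>

lemma card_symbols_bound:
  fixes A :: "'r \<Rightarrow> 'k \<Rightarrow> 'a" and r :: "nat \<Rightarrow> 'r" and m :: "nat \<Rightarrow> 'k"
  assumes fin: "finite R" "finite K"
    and r: "inj_on r {..h}" "r ` {..h} \<subseteq> R" and m: "inj_on m {..h}" "m ` {..h} \<subseteq> K"
    and T: "rainbow A T" "T \<subseteq> R \<times> K" "r 0 \<notin> fst ` T" "m 0 \<notin> snd ` T"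
    and rmT: "\<And>s. s \<in> {1..h} \<Longrightarrow> (r s, m s) \<in> T"
    and M: "\<And>s. s \<le> h \<Longrightarrow> inj_on snd (M s) \<and> M s \<subseteq> R \<times> K \<and> m s \<notin> snd ` M s"
    and conflict: "\<And>s x. s \<le> h \<Longrightarrow> x \<in> R \<Longrightarrow> x \<notin> r ` {s<..h} \<Longrightarrow> (x, m s) \<notin> T \<Longrightarrow>
        A x (m s) \<notin> case_prod A ` T \<Longrightarrow>
        \<exists>q. (x, q) \<in> M s \<and> q \<notin> m ` {s<..h} \<and>
          (A (r s) q \<in> case_prod A ` T \<or> A (r s) q = A x (m s))"
  shows "2 * card (case_prod A ` (R \<times> K)) + 2 * (h + 1) * card R
    \<le> 2 * card R * card K + h * (h + 1) + 2 * h"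
proof -
  let ?Sy = "case_prod A ` T"
  \<comment> \<open>\<open>I\<close> indexes the pairs of cells, one for each column
    \<open>m s\<close> and row \<open>x\<close>. Later rows \<open>r t\<close> are skipped to keep
    the pairs of different \<open>s\<close> apart, and cells of \<open>T\<close> are skipped because
    they must stay.\<close>
  define I where "I = (SIGMA s:{..h}. {x \<in> R - r ` {s<..h}. (x, m s) \<notin> T})"
  have finI: "finite I" unfolding I_def using fin by auto
  have "\<exists>q. A x (m s) \<notin> ?Sy \<longrightarrow> (x, q) \<in> M s \<and> q \<notin> m ` {s<..h} \<and>
          (A (r s) q \<in> ?Sy \<or> A (r s) q = A x (m s))" if "(s, x) \<in> I" for s x
    using conflict[of s x] that unfolding I_def by auto
  then obtain q where q: "\<And>s x. (s, x) \<in> I \<Longrightarrow> A x (m s) \<notin> ?Sy \<Longrightarrow>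
      (x, q s x) \<in> M s \<and> q s x \<notin> m ` {s<..h} \<and>
      (A (r s) (q s x) \<in> ?Sy \<or> A (r s) (q s x) = A x (m s))"
    by metis
  have q_ne: "q s x \<noteq> m s" if "(s, x) \<in> I" "A x (m s) \<notin> ?Sy" for s x
    using q[OF that] M[of s] that unfolding I_def by force
  have q_inj: "x = y" if "(s, x) \<in> I" "A x (m s) \<notin> ?Sy" "(s, y) \<in> I" "A y (m s) \<notin> ?Sy"
    "q s x = q s y" for s x y
  proof -
    have "inj_on snd (M s)" using M[of s] that(1) unfolding I_def by auto
    then have "(x, q s x) = (y, q s y)"
      using q[OF that(1,2)] q[OF that(3,4)] that(5) by (intro inj_onD[of snd "M s"]) auto
    then show ?thesis by simp
  qed
  \<comment> \<open>The cells of index \<open>s\<close> lie in column \<open>m s\<close> or row \<open>r s\<close>; leaving out the crossings with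
    later rows and columns makes these regions disjoint.\<close>
  define Z where "Z s = {(x, p). (p = m s \<and> x \<notin> r ` {s<..h}) \<or> (x = r s \<and> p \<notin> m ` {s..h})}" for s
  have Z_less: "z \<notin> Z s'" if "z \<in> Z s" "s < s'" "s' \<le> h" for z s s'
  proof
    assume z': "z \<in> Z s'"
    have 1: "r s' \<in> r ` {s<..h}" "m s' \<in> m ` {s..h}" using that by auto
    have 2: "m s \<noteq> m s'" "r s \<noteq> r s'"
      using that inj_onD[OF m(1), of s s'] inj_onD[OF r(1), of s s'] by auto
    show False using that(1) z' 1 2 unfolding Z_def by auto
  qed
  have Z_eq: "s = s'" if "z \<in> Z s" "z \<in> Z s'" "s \<le> h" "s' \<le> h" for z s s'
    using Z_less that by (metis linorder_neqE_nat)
  \<comment> \<open>\<open>w\<close> selects the cell to discard. The row cell goes only if its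
    symbol is present on \<open>T\<close>. Otherwise the column cell goes: its symbol is either on
    \<open>T\<close> or equal to that of the row cell. The first conjunct ensures that
    \<open>q s x\<close> is used only where it is specified.\<close>
  define w where "w = (\<lambda>(s, x). if A x (m s) \<notin> ?Sy \<and> A (r s) (q s x) \<in> ?Sy
      then (r s, q s x) else (x, m s))"
  have col_Z: "(x, m s) \<in> Z s" if "(s, x) \<in> I" for s x
    using that unfolding I_def Z_def by auto
  have row_Z: "(r s, q s x) \<in> Z s" if "(s, x) \<in> I" "A x (m s) \<notin> ?Sy" for s x
  proof -
    have "{s..h} = insert s {s<..h}" using that unfolding I_def by auto
    then show ?thesis using q[OF that] q_ne[OF that] unfolding Z_def by auto
  qed
  have w_Z: "w (s, x) \<in> Z s" if "(s, x) \<in> I" for s x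
    using col_Z[OF that] row_Z[OF that] unfolding w_def by auto
  have s_le: "s \<le> h" if "(s, x) \<in> I" for s x using that unfolding I_def by auto
  have w_inj: "inj_on w I"
  proof (rule inj_onI)
    fix a b assume a: "a \<in> I" and b: "b \<in> I" and ab: "w a = w b"
    obtain s x where sx: "a = (s, x)" by fastforce
    obtain s' y where sy: "b = (s', y)" by fastforce
    have s: "s' = s" using Z_eq[of "w a" s s'] w_Z s_le a b ab sx sy by metis
    have "x = y"
      using ab q_ne[of s x] q_ne[of s y] q_inj[of s x y] a b unfolding sx sy s w_def
      by (auto split: if_splits)
    then show "a = b" using sx sy s by simp
  qed
  have r_T: "(r s, q s x) \<notin> T" if "(s, x) \<in> I" "A x (m s) \<notin> ?Sy" for s x
  proof (cases "s = 0")
    case True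
    then show ?thesis using T(3) by force
  next
    case False
    then have "(r s, m s) \<in> T" using rmT[of s] s_le[OF that(1)] by simp
    then show ?thesis using rainbow_fstD[OF T(1)] q_ne[OF that] by metis
  qed
  have w_T: "w (s, x) \<notin> T" if "(s, x) \<in> I" for s x
    using r_T[OF that] that unfolding w_def I_def by auto
  have w_RK: "w ` I \<subseteq> R \<times> K"
  proof
    fix z assume "z \<in> w ` I"
    then obtain s x where sx: "(s, x) \<in> I" and w: "z = w (s, x)" by auto
    have sh: "s \<le> h" using s_le[OF sx] .
    have "x \<in> R" "r s \<in> R" "m s \<in> K" using sx r(2) m(2) sh unfolding I_def by auto
    moreover have "q s x \<in> K" if "A x (m s) \<notin> ?Sy" using q[OF sx that] M[OF sh] by auto
    ultimately show "z \<in> R \<times> K" using w unfolding w_def by (auto split: if_splits)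
  qed
  \<comment> \<open>No symbol is lost: cells of \<open>T\<close> are never discarded, and a
    discarded symbol that is not on \<open>T\<close> is still carried by the row cell of the same
    pair.\<close>
  have keep: "case_prod A ` (R \<times> K) \<subseteq> case_prod A ` (R \<times> K - w ` I)"
  proof
    fix c assume "c \<in> case_prod A ` (R \<times> K)"
    then obtain z where z: "z \<in> R \<times> K" "c = case_prod A z" by blast
    have TK: "?Sy \<subseteq> case_prod A ` (R \<times> K - w ` I)" using T(2) w_T by force
    show "c \<in> case_prod A ` (R \<times> K - w ` I)"
    proof (cases "z \<in> w ` I \<and> c \<notin> ?Sy")
      case False
      then show ?thesis using z TK by blast
    next
      case True
      then obtain s x where sx: "(s, x) \<in> I" "z = w (s, x)" by auto
      have nSy: "A x (m s) \<notin> ?Sy" and zx: "z = (x, m s)" and nr: "A (r s) (q s x) \<notin> ?Sy"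
        using True sx z unfolding w_def by (auto split: if_splits)
      have sh: "s \<le> h" using s_le[OF sx(1)] .
      have eq: "A (r s) (q s x) = c" using q[OF sx(1) nSy] nr z zx by auto
      have "(r s, q s x) \<notin> w ` I"
      proof
        assume "(r s, q s x) \<in> w ` I"
        then obtain s' y where y: "(s', y) \<in> I" "w (s', y) = (r s, q s x)" by force
        have "s' = s" using Z_eq row_Z[OF sx(1) nSy] w_Z[OF y(1)] y s_le sh by metis
        then show False
          using y nr q_ne[OF sx(1) nSy] unfolding w_def by (auto split: if_splits)
      qed
      moreover have "r s \<in> R" "q s x \<in> K" using r(2) sh q[OF sx(1) nSy] M[OF sh] by auto
      ultimately show ?thesis using eq by force
    qed
  qed
  have "card (case_prod A ` (R \<times> K)) \<le> card (R \<times> K - w ` I)"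
    by (rule order_trans[OF card_mono[OF _ keep] card_image_le]) (use fin in auto)
  also have "\<dots> = card R * card K - card I"
    using w_RK finI fin by (simp add: card_Diff_subset card_image[OF w_inj] card_cartesian_product)
  finally have 1: "card (case_prod A ` (R \<times> K)) \<le> card R * card K - card I" .
  have "card I \<le> card R * card K"
    using card_mono[OF _ w_RK] fin by (simp add: card_image[OF w_inj] card_cartesian_product)
  with 1 have 2: "card (case_prod A ` (R \<times> K)) + card I \<le> card R * card K" by simp
  \<comment> \<open>At most \<open>h - s\<close> rows are skipped as later rows, and one more
    because \<open>T\<close> meets column \<open>m s\<close>; the latter does not happen for
    \<open>s = 0\<close>. These single cells add up to the term \<open>2 * h\<close> of the
    conclusion, after doubling.\<close>
  have part: "card R + s \<le> card {x \<in> R - r ` {s<..h}. (x, m s) \<notin> T} + h + (if s = 0 then 0 else 1)"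
    (is "_ \<le> card ?P + h + ?d") if "s \<le> h" for s
  proof -
    let ?Q = "{x. (x, m s) \<in> T}"
    have sub: "R \<subseteq> ?P \<union> r ` {s<..h} \<union> ?Q" by auto
    have Q: "finite ?Q \<and> card ?Q \<le> ?d"
    proof (cases "s = 0")
      case True
      then have "?Q = {}" using T(4) by force
      then show ?thesis by (metis card.empty finite.emptyI le0)
    next
      case False
      then have "(r s, m s) \<in> T" using rmT[of s] that by simp
      then have "?Q = {r s}" using rainbow_sndD[OF T(1)] by blast
      then show ?thesis using False by simp
    qed
    have "card (r ` {s<..h}) \<le> h - s" using card_image_le[of "{s<..h}" r] by simp
    moreover have "card R \<le> card (?P \<union> r ` {s<..h} \<union> ?Q)"
      by (rule card_mono[OF _ sub]) (use fin Q in auto)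
    moreover have "card (?P \<union> r ` {s<..h} \<union> ?Q) \<le> card ?P + card (r ` {s<..h}) + card ?Q"
      using card_Un_le[of "?P \<union> r ` {s<..h}" ?Q] card_Un_le[of ?P "r ` {s<..h}"] by linarith
    ultimately show ?thesis using Q that by linarith
  qed
  have "(\<Sum>s\<le>h. card R + s) \<le> (\<Sum>s\<le>h. card {x \<in> R - r ` {s<..h}. (x, m s) \<notin> T} + h + (if s = 0 then 0 else 1))"
    by (rule sum_mono) (use part in auto)
  also have "\<dots> = card I + (h + 1) * h + h"
  proof -
    have "(\<Sum>s\<le>h. if s = 0 then 0 else 1) = h" by (induction h) auto
    moreover have "(\<Sum>s\<le>h. card {x \<in> R - r ` {s<..h}. (x, m s) \<notin> T}) = card I"
      unfolding I_def using fin by (subst card_SigmaI) auto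
    ultimately show ?thesis by (simp add: sum.distrib)
  qed
  finally have "(h + 1) * card R + (\<Sum>s\<le>h. s) \<le> card I + (h + 1) * h + h"
    by (simp add: sum.distrib)
  moreover have "2 * (\<Sum>s\<le>h. s) = h * (h + 1)" by (induction h) auto
  ultimately have 3: "2 * (h + 1) * card R \<le> 2 * card I + h * (h + 1) + 2 * h"
    by (simp add: algebra_simps)
  show ?thesis using 2 3 by (simp add: algebra_simps)
qed

text \<open>With \<open>c = (5 - sqrt 5) / 4\<close>, the threshold for \<open>h\<close> is
  \<open>(2c - 1) n + (1 - c)\<close>, the quantity that appears in \<open>card_exclusive\<close>.
  If \<open>h + 1\<close> is put equal to it, the quadratic terms match \<open>c n^2\<close> and the
  linear terms cancel; only the constant \<open>(1 - c) (2 - c)\<close> is left, and it is below the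
  2 that is needed.\<close>

lemma numeric_contradiction:
  fixes n D h :: nat
  assumes "(5 - sqrt 5) / 4 * real n ^ 2 \<le> real D"
    and "2 * D + 2 * (h + 1) * n \<le> 2 * n * n + h * (h + 1) + 2 * h"
    and "(3 - sqrt 5) / 2 * real n + (sqrt 5 - 1) / 4 \<le> real h" "h + 1 \<le> n"
  shows False
proof -
  define q where "q = sqrt 5"
  have q2: "q * q = 5" unfolding q_def by simp
  define N H where "N = real n" and "H = real h"
  define u where "u = (3 - q) / 2 * N + (q - 1) / 4"
  have "real (2 * D + 2 * (h + 1) * n) \<le> real (2 * n * n + h * (h + 1) + 2 * h)"
    using assms(2) of_nat_le_iff by blast
  then have 1: "2 * real D + 2 * (H + 1) * N \<le> 2 * N * N + H * (H + 1) + 2 * H"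
    unfolding N_def H_def by (simp add: algebra_simps)
  have 2: "(5 - q) / 4 * N ^ 2 \<le> real D" using assms(1) unfolding q_def N_def .
  have 3: "u \<le> H" using assms(3) unfolding u_def q_def N_def H_def .
  have 4: "H + 1 \<le> N" using assms(4) unfolding H_def N_def by simp
  \<comment> \<open>The product is the difference of the values of
    \<open>2 * N * y - y * (y + 1)\<close> at \<open>y = H + 1\<close> and \<open>y = u\<close>, so
    \<open>H\<close> may be replaced by the threshold.\<close>
  have "(H + 1 - u) * (2 * N - (H + u + 2)) \<ge> 0"
    using 3 4 by (intro mult_nonneg_nonneg) auto
  then have 5: "2 * N * (H + 1) - (H + 1) * (H + 2) \<ge> 2 * N * u - u * (u + 1)"
    by (simp add: algebra_simps)
  have 6: "2 * N * u - u * (u + 1) = (q - 1) / 2 * N ^ 2 - ((q - 1) / 4) * ((q - 1) / 4 + 1)"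
  proof -
    have "2 * N * u - u * (u + 1) - ((q - 1) / 2 * N ^ 2 - ((q - 1) / 4) * ((q - 1) / 4 + 1))
      = (5 - q * q) * (N * N / 4 - N / 4)"
      unfolding u_def by (simp add: field_simps power2_eq_square)
    then show ?thesis using q2 by simp
  qed
  have "(q - 1) / 4 * ((q - 1) / 4 + 1) < 2"
  proof -
    have "q < 3" unfolding q_def by (rule real_less_lsqrt) auto
    moreover have "1 < q" unfolding q_def by simp
    ultimately show ?thesis using q2 by (simp add: field_simps)
  qed
  moreover have "2 * N * (H + 1) - (H + 1) * (H + 2) + 2 \<le> 2 * N * N - 2 * real D"
    using 1 by (simp add: algebra_simps)
  moreover have "2 * N * N - 2 * real D \<le> (q - 1) / 2 * N ^ 2"
    using 2 by (simp add: field_simps power2_eq_square)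
  ultimately show False using 5 6 by linarith
qed

section \<open>Minimal counterexamples\<close>

text \<open>A list of \<open>P\<close> followed by a list of \<open>S - P\<close> gives the order.
  Numbering starts at 1 because index 0 is kept for the row and column missed by the initial partial
  transversal.\<close>

lemma bij_betw_initial:
  assumes "finite S" "P \<subseteq> S"
  obtains f :: "nat \<Rightarrow> 'b" where "bij_betw f {1..card S} S"
    "\<And>s t. s \<in> {1..card S} \<Longrightarrow> t \<in> {1..card S} \<Longrightarrow> s < t \<Longrightarrow> f t \<in> P \<Longrightarrow> f s \<in> P"
proof -
  obtain xs where xs: "set xs = P" "distinct xs"
    using finite_distinct_list finite_subset[OF assms(2,1)] by blast
  obtain ys where ys: "set ys = S - P" "distinct ys"
    using finite_distinct_list[of "S - P"] assms(1) by blast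
  let ?z = "xs @ ys"
  have z: "distinct ?z" "set ?z = S" using xs ys assms(2) by auto
  then have len: "length ?z = card S" using distinct_card by metis
  let ?f = "\<lambda>s. ?z ! (s - 1)"
  have bij1: "bij_betw (\<lambda>s. s - 1) {1..card S} {..<card S}"
    by (rule bij_betw_byWitness[where f' = Suc]) auto
  have bij2: "bij_betw (\<lambda>i. ?z ! i) {..<card S} S"
    by (rule bij_betw_nth[OF z(1)]) (simp_all only: len z(2))
  have "bij_betw ?f {1..card S} S"
    using bij_betw_trans[OF bij1 bij2] by (simp add: comp_def)
  moreover have "?f s \<in> P" if "s \<in> {1..card S}" "t \<in> {1..card S}" "s < t" "?f t \<in> P" for s t
  proof -
    have "t - 1 < length xs"
    proof (rule ccontr)
      assume "\<not> t - 1 < length xs"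
      then have "?f t = ys ! (t - 1 - length xs)" "t - 1 - length xs < length ys"
        using that(2) len by (auto simp: nth_append)
      then have "?f t \<in> set ys" by simp
      then show False using that(4) ys by auto
    qed
    then have "s - 1 < length xs" using that(3) by linarith
    then have "?f s = xs ! (s - 1)" "xs ! (s - 1) \<in> set xs" by (simp_all add: nth_append)
    then show ?thesis using xs by simp
  qed
  ultimately show ?thesis using that by blast
qed

text \<open>Minimality enters only through \<open>minor\<close>, that is, for the deletion of one
  row and one column.\<close>

locale counterexample =
  fixes R :: "'r set" and K :: "'k set" and A :: "'r \<Rightarrow> 'k \<Rightarrow> 'a" and n :: nat
  assumes fin: "finite R" "finite K" and card_R: "card R = n" and card_K: "card K = n"
    and n_ge: "2 \<le> n"
    and row: "\<And>i. i \<in> R \<Longrightarrow> inj_on (A i) K"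
    and no_transversal: "\<And>T. T \<subseteq> R \<times> K \<Longrightarrow> rainbow A T \<Longrightarrow> card T \<noteq> n"
    and many: "(5 - sqrt 5) / 4 * real n ^ 2 \<le> real (card (case_prod A ` (R \<times> K)))"
    and minor: "\<And>i j. i \<in> R \<Longrightarrow> j \<in> K \<Longrightarrow>
      (\<And>T. T \<subseteq> (R - {i}) \<times> (K - {j}) \<Longrightarrow> rainbow A T \<Longrightarrow> card T \<noteq> n - 1) \<Longrightarrow>
      real (card (case_prod A ` ((R - {i}) \<times> (K - {j})))) < (5 - sqrt 5) / 4 * real (n - 1) ^ 2"
begin

section \<open>Blocked cells, exclusive symbols and singletons\<close>

definition blocked :: "'r \<Rightarrow> 'k \<Rightarrow> bool" where
  "blocked i j \<longleftrightarrow>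
    (\<forall>T. T \<subseteq> (R - {i}) \<times> (K - {j}) \<longrightarrow> rainbow A T \<longrightarrow> card T \<noteq> n - 1)"

definition lost :: "'r \<Rightarrow> 'k \<Rightarrow> 'a set" where
  "lost i j = case_prod A ` (R \<times> K) - case_prod A ` ((R - {i}) \<times> (K - {j}))"

definition exclusive :: "'k \<Rightarrow> 'a set" where
  "exclusive j = (\<lambda>i. A i j) ` R - case_prod A ` (R \<times> (K - {j}))"

definition singleton :: "'r \<Rightarrow> 'k \<Rightarrow> bool" where
  "singleton i j \<longleftrightarrow> i \<in> R \<and> j \<in> K \<and> (\<forall>x\<in>R. \<forall>p\<in>K. A x p = A i j \<longrightarrow> x = i \<and> p = j)"

lemma rowD: "i \<in> R \<Longrightarrow> p \<in> K \<Longrightarrow> q \<in> K \<Longrightarrow> A i p = A i q \<Longrightarrow> p = q"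
  using row inj_onD by metis

lemma finite_subset_RK: "T \<subseteq> R \<times> K \<Longrightarrow> finite T"
  using fin finite_subset by blast

lemma exclusiveD: "v \<in> exclusive j \<Longrightarrow> x \<in> R \<Longrightarrow> p \<in> K \<Longrightarrow> A x p = v \<Longrightarrow> p = j"
  unfolding exclusive_def using case_prod_imageI[of x p "R \<times> (K - {j})" A] by auto

lemma singleton_notin:
  assumes "singleton i j" "S \<subseteq> R \<times> K" "(i, j) \<notin> S"
  shows "A i j \<notin> case_prod A ` S"
proof
  assume "A i j \<in> case_prod A ` S"
  then obtain x p where "(x, p) \<in> S" "A x p = A i j" by (elim imageE) auto
  then show False using assms unfolding singleton_def by blast
qed

lemma singleton_exclusive:
  assumes "singleton i j"
  shows "A i j \<in> exclusive j"
proof -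
  have "A i j \<notin> case_prod A ` (R \<times> (K - {j}))"
    by (rule singleton_notin[OF assms]) auto
  then show ?thesis using assms unfolding exclusive_def singleton_def by blast
qed

text \<open>Of at least \<open>c n^2\<close> symbols fewer than \<open>c (n - 1)^2\<close> survive
  the deletion, by \<open>minor\<close>; here \<open>c = (5 - sqrt 5) / 4\<close>.\<close>

lemma card_lost:
  assumes "i \<in> R" "j \<in> K" "blocked i j"
  shows "(5 - sqrt 5) / 4 * (2 * real n - 1) < real (card (lost i j))"
proof -
  let ?c = "(5 - sqrt 5) / 4"
  let ?m = "case_prod A ` ((R - {i}) \<times> (K - {j}))"
  have sub: "?m \<subseteq> case_prod A ` (R \<times> K)" by auto
  have "card (lost i j) = card (case_prod A ` (R \<times> K)) - card ?m"
    unfolding lost_def by (rule card_Diff_subset) (use fin sub in auto)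
  moreover have "card ?m \<le> card (case_prod A ` (R \<times> K))"
    by (rule card_mono[OF _ sub]) (use fin in auto)
  ultimately have "real (card (lost i j)) = real (card (case_prod A ` (R \<times> K))) - real (card ?m)"
    by simp
  moreover have "real (card ?m) < ?c * real (n - 1) ^ 2"
    by (rule minor[OF assms(1,2)]) (use assms(3) in \<open>auto simp: blocked_def\<close>)
  moreover have "real (n - 1) = real n - 1" using n_ge by simp
  moreover have "c * real n ^ 2 = c * (real n - 1) ^ 2 + c * (2 * real n - 1)" for c
    by (simp add: power2_eq_square algebra_simps)
  ultimately show ?thesis using many by (smt (verit, best))
qed

text \<open>A lost symbol occurs only in row \<open>i\<close> or column \<open>j\<close>. If it
  avoids the other \<open>n - 1\<close> cells of row \<open>i\<close>, it is exclusive to column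
  \<open>j\<close>. The bound is therefore \<open>c (2n - 1) - (n - 1)\<close>.\<close>

lemma card_exclusive:
  assumes "i \<in> R" "j \<in> K" "blocked i j"
  shows "(3 - sqrt 5) / 2 * real n + (sqrt 5 - 1) / 4 < real (card (exclusive j))"
proof -
  have "lost i j \<subseteq> exclusive j \<union> A i ` (K - {j})"
  proof
    fix v assume v: "v \<in> lost i j"
    then obtain x p where xp: "x \<in> R" "p \<in> K" "v = A x p" unfolding lost_def by auto
    have only: "y = i \<or> q = j" if "y \<in> R" "q \<in> K" "A y q = v" for y q
      using v that case_prod_imageI[of y q "(R - {i}) \<times> (K - {j})" A] unfolding lost_def by auto
    show "v \<in> exclusive j \<union> A i ` (K - {j})"
    proof (cases "v \<in> A i ` (K - {j})")
      case False
      have all: "q = j" if "y \<in> R" "q \<in> K" "A y q = v" for y q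
        using only[OF that] that False by auto
      then have "p = j" using xp by blast
      then have "v \<in> (\<lambda>i. A i j) ` R" using xp by blast
      moreover have "v \<notin> case_prod A ` (R \<times> (K - {j}))" using all by auto
      ultimately have "v \<in> exclusive j" unfolding exclusive_def by blast
      then show ?thesis by blast
    qed simp
  qed
  moreover have "finite (exclusive j)" using fin unfolding exclusive_def by auto
  ultimately have "card (lost i j) \<le> card (exclusive j \<union> A i ` (K - {j}))"
    using fin by (intro card_mono) auto
  also have "\<dots> \<le> card (exclusive j) + card (A i ` (K - {j}))" by (rule card_Un_le)
  also have "card (A i ` (K - {j})) \<le> card (K - {j})" using fin by (intro card_image_le) auto
  also have "card (K - {j}) = n - 1" using assms(2) card_K fin by simp
  finally have "real (card (lost i j)) \<le> real (card (exclusive j)) + (real n - 1)"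
    using n_ge by linarith
  with card_lost[OF assms] show ?thesis by (simp add: field_simps)
qed

text \<open>A transversal of the remaining array would extend by the cell \<open>(i, j)\<close>,
  whose symbol occurs nowhere else.\<close>

lemma singleton_blocked:
  assumes "singleton i j"
  shows "blocked i j"
  unfolding blocked_def
proof (intro allI impI)
  fix T assume T: "T \<subseteq> (R - {i}) \<times> (K - {j})" "rainbow A T"
  have ij: "i \<in> R" "j \<in> K" using assms unfolding singleton_def by auto
  have finT: "finite T" using T(1) by (intro finite_subset_RK) auto
  have "A i j \<notin> case_prod A ` T" by (rule singleton_notin[OF assms]) (use T(1) in auto)
  moreover have "i \<notin> fst ` T" "j \<notin> snd ` T" using T(1) by auto
  ultimately have "rainbow A (insert (i, j) T)" using T(2) by (intro rainbow_insert)
  then have "card (insert (i, j) T) \<noteq> n" using T(1) ij by (intro no_transversal) auto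
  moreover have "(i, j) \<notin> T" using T(1) by auto
  ultimately show "card T \<noteq> n - 1" using finT n_ge by auto
qed

text \<open>Double counting of cells: a symbol that occurs more than once takes at least two of the
  \<open>n^2\<close> cells, which forces at least \<open>(2c - 1) n^2\<close> symbols that occur
  once. A column holds at most \<open>n\<close> of them.\<close>

lemma card_singleton_columns:
  "(3 - sqrt 5) / 2 * real n \<le> real (card {j \<in> K. \<exists>i. singleton i j})" (is "_ \<le> real (card ?C)")
proof -
  let ?V = "case_prod A ` (R \<times> K)" and ?S = "case_prod A ` {(i, j). singleton i j}"
  have SV: "?S \<subseteq> ?V" unfolding singleton_def by auto
  have finV: "finite ?V" using fin by auto
  have "{(i, j). singleton i j} \<subseteq> R \<times> ?C" unfolding singleton_def by auto
  then have "card ?S \<le> card (R \<times> ?C)"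
    using fin by (intro surj_card_le[of _ _ "case_prod A"]) auto
  then have S: "card ?S \<le> n * card ?C" by (simp add: card_cartesian_product card_R)
  have "(\<Sum>v\<in>?V. if v \<in> ?S then 1 else 2) \<le> (\<Sum>v\<in>?V. card {z \<in> R \<times> K. case_prod A z = v})"
  proof (rule sum_mono)
    fix v assume "v \<in> ?V"
    then obtain i j where ij: "i \<in> R" "j \<in> K" "v = A i j" by auto
    let ?F = "{z \<in> R \<times> K. case_prod A z = v}"
    have finF: "finite ?F" using fin by auto
    show "(if v \<in> ?S then 1 else 2) \<le> card ?F"
    proof (cases "v \<in> ?S")
      case True
      have "?F \<noteq> {}" using ij by auto
      then show ?thesis using True finF by (simp add: Suc_leI card_gt_0_iff)
    next
      case False
      then have "\<not> singleton i j" using ij by auto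
      then obtain x p where "x \<in> R" "p \<in> K" "A x p = v" "(x, p) \<noteq> (i, j)"
        using ij unfolding singleton_def by blast
      then have "{(x, p), (i, j)} \<subseteq> ?F" and two: "card {(x, p), (i, j)} = 2" using ij by auto
      then have "2 \<le> card ?F" using card_mono[OF finF, of "{(x, p), (i, j)}"] by linarith
      then show ?thesis using False by simp
    qed
  qed
  also have "\<dots> = card (R \<times> K)"
    using sum.image_gen[of "R \<times> K" "\<lambda>_. 1::nat" "case_prod A"] fin by simp
  also have "\<dots> = n * n" by (simp add: card_cartesian_product card_R card_K)
  finally have "(\<Sum>v\<in>?V. if v \<in> ?S then 1 else (2::nat)) \<le> n * n" .
  moreover have "(\<Sum>v\<in>?V. if v \<in> ?S then 1 else (2::nat)) + card ?S = 2 * card ?V"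
  proof -
    have "(\<Sum>v\<in>?V. if v \<in> ?S then 1 else (2::nat)) = card ?S + 2 * card (?V - ?S)"
      using finV SV by (simp add: sum.If_cases Int_absorb1 Diff_eq)
    moreover have "card ?V = card ?S + card (?V - ?S)"
      using card_Un_disjoint[of ?S "?V - ?S"] finV finite_subset[OF SV finV] Un_absorb1[OF SV]
      by (simp add: Un_Diff_cancel)
    ultimately show ?thesis by simp
  qed
  ultimately have "2 * card ?V \<le> n * n + n * card ?C" using S by linarith
  then have "real (2 * card ?V) \<le> real (n * n + n * card ?C)"
    using of_nat_le_iff by blast
  then have "2 * real (card ?V) \<le> real n * real n + real n * real (card ?C)" by simp
  with many have "2 * ((5 - sqrt 5) / 4 * real n ^ 2) \<le> real n * real n + real n * real (card ?C)"
    by linarith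
  then have "real n * ((3 - sqrt 5) / 2 * real n) \<le> real n * real (card ?C)"
    by (simp add: power2_eq_square field_simps)
  then show ?thesis using n_ge by simp
qed

text \<open>If \<open>(l, j)\<close> carries an exclusive symbol and \<open>(l, p)\<close> is the cell of \<open>T\<close> in row \<open>l\<close>, then
  the symbol of \<open>(i, p)\<close> is that of some cell of \<open>T\<close>; exchanging this cell and \<open>(l, p)\<close> for
  \<open>(i, p)\<close> and \<open>(l, j)\<close> frees its row and column. The freed rows that are themselves such an
  \<open>l\<close> are enumerated first, to avoid later columns in the hypothesis \<open>conflict\<close> of \<open>card_symbols_bound\<close>.\<close>

lemma exclusive_column_false:
  assumes i: "i \<in> R" and j: "j \<in> K"
    and T: "T \<subseteq> (R - {i}) \<times> (K - {j})" "rainbow A T" "card T = n - 1"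
    and many_excl: "(3 - sqrt 5) / 2 * real n + (sqrt 5 - 1) / 4 < real (card (exclusive j))"
  shows False
proof -
  let ?Sy = "case_prod A ` T"
  have T_RK: "T \<subseteq> R \<times> K" using T(1) by auto
  have finT: "finite T" by (rule finite_subset_RK[OF T_RK])
  have iT: "i \<notin> fst ` T" and jT: "j \<notin> snd ` T" using T(1) by auto
  have inj_fst: "inj_on fst T" and inj_snd: "inj_on snd T" using T(2) unfolding rainbow_def by auto
  have no_card: "card T' \<noteq> Suc (card T)" if "T' \<subseteq> R \<times> K" "rainbow A T'" for T'
    using no_transversal[OF that] T(3) n_ge by simp
  have ij_Sy: "A i j \<in> ?Sy"
  proof (rule ccontr)
    assume "A i j \<notin> ?Sy"
    then have "rainbow A (insert (i, j) T)" using T(2) iT jT by (intro rainbow_insert)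
    moreover have "card (insert (i, j) T) = Suc (card T)" using finT T(1) by (intro card_insert_disjoint) auto
    ultimately show False using no_card[of "insert (i, j) T"] T_RK i j by auto
  qed
  have "fst ` T = R - {i}"
  proof (rule card_subset_eq)
    show "fst ` T \<subseteq> R - {i}" using T(1) by auto
    show "card (fst ` T) = card (R - {i})"
      using card_image[OF inj_fst] T(3) card_R i fin by simp
  qed (use fin in simp)
  then have "\<exists>p. (x, p) \<in> T" if "x \<in> R - {i}" for x
  proof -
    have "x \<in> fst ` T" using that \<open>fst ` T = R - {i}\<close> by blast
    then show ?thesis by (elim imageE) (metis prod.collapse)
  qed
  then obtain \<sigma> where \<sigma>: "\<And>x. x \<in> R - {i} \<Longrightarrow> (x, \<sigma> x) \<in> T" by metis
  have \<sigma>_K: "\<sigma> x \<in> K" "\<sigma> x \<noteq> j" if "x \<in> R - {i}" for x using \<sigma>[OF that] T(1) by auto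
  have \<sigma>_inj: "x = y" if "x \<in> R - {i}" "y \<in> R - {i}" "\<sigma> x = \<sigma> y" for x y
    using rainbow_sndD[OF T(2)] \<sigma> that by metis
  have T_\<sigma>: "x \<in> R - {i} \<and> p = \<sigma> x" if "(x, p) \<in> T" for x p
    using rainbow_fstD[OF T(2) that] \<sigma>[of x] T(1) that by blast
  have excl_notin: "A l j \<notin> case_prod A ` S" if "A l j \<in> exclusive j" "S \<subseteq> T" for l S
    using exclusiveD[OF that(1)] that(2) T(1) by fastforce
  define Y where "Y = {l \<in> R - {i}. A l j \<in> exclusive j}"
  have finY: "finite Y" and Y_R: "Y \<subseteq> R - {i}" using fin unfolding Y_def by auto
  \<comment> \<open>Leaving row \<open>i\<close> out of \<open>Y\<close> costs nothing: the symbol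
    of \<open>(i, j)\<close> occurs on \<open>T\<close>, hence in another column, and is not
    exclusive.\<close>
  have "exclusive j \<subseteq> (\<lambda>l. A l j) ` Y"
  proof
    fix v assume v: "v \<in> exclusive j"
    then obtain l where l: "l \<in> R" "v = A l j" unfolding exclusive_def by auto
    have "l \<noteq> i" using excl_notin[of l T] v l ij_Sy by auto
    then show "v \<in> (\<lambda>l. A l j) ` Y" using v l unfolding Y_def by auto
  qed
  then have card_Y: "card (exclusive j) \<le> card Y"
    using finY by (meson card_image_le card_mono finite_imageI le_trans)
  have "\<exists>x. x \<in> R - {i} \<and> x \<noteq> l \<and> A i (\<sigma> l) = A x (\<sigma> x)" if l: "l \<in> Y" for l
  proof -
    have lR: "l \<in> R - {i}" and ex: "A l j \<in> exclusive j" using l unfolding Y_def by auto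
    have "A i (\<sigma> l) \<in> case_prod A ` (T - {(l, \<sigma> l)})"
    proof (rule ccontr)
      assume c: "A i (\<sigma> l) \<notin> case_prod A ` (T - {(l, \<sigma> l)})"
      have ne: "A l j \<noteq> A i (\<sigma> l)" using exclusiveD[OF ex i \<sigma>_K(1)[OF lR]] \<sigma>_K(2)[OF lR] by metis
      have sub: "insert (i, \<sigma> l) (insert (l, j) (T - {(l, \<sigma> l)})) \<subseteq> R \<times> K"
        using T_RK i j lR \<sigma>_K(1)[OF lR] by blast
      show False
        using rainbow_swap[OF T(2) \<sigma>[OF lR] iT jT excl_notin[OF ex] c ne finT] no_card[OF sub] by blast
    qed
    then obtain x p where xp: "(x, p) \<in> T" "(x, p) \<noteq> (l, \<sigma> l)" "A i (\<sigma> l) = A x p" by auto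
    then show ?thesis using T_\<sigma>[OF xp(1)] by auto
  qed
  then obtain \<mu> where \<mu>: "\<And>l. l \<in> Y \<Longrightarrow> \<mu> l \<in> R - {i} \<and> \<mu> l \<noteq> l \<and> A i (\<sigma> l) = A (\<mu> l) (\<sigma> (\<mu> l))"
    by metis
  \<comment> \<open>The row \<open>\<mu> l\<close> determines the symbol of
    \<open>(i, \<sigma> l)\<close>, and row \<open>i\<close> is row-Latin. Thus different exclusive
    symbols free different rows.\<close>
  have \<mu>_inj: "inj_on \<mu> Y"
  proof (rule inj_onI)
    fix l l' assume l: "l \<in> Y" "l' \<in> Y" "\<mu> l = \<mu> l'"
    then have "A i (\<sigma> l) = A i (\<sigma> l')" using \<mu> by metis
    then have "\<sigma> l = \<sigma> l'" using rowD[OF i] \<sigma>_K(1) l Y_R by blast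
    then show "l = l'" using \<sigma>_inj l Y_R by blast
  qed
  have Y_Sy: "A i (\<sigma> l) \<in> ?Sy" if "l \<in> Y" for l
    using \<mu>[OF that] case_prod_imageI[OF \<sigma>] by metis
  define h where "h = card Y"
  have card_M: "card (\<mu> ` Y) = h" unfolding h_def by (rule card_image[OF \<mu>_inj])
  obtain r0 where r0: "bij_betw r0 {1..h} (\<mu> ` Y)"
    and r0_Y: "\<And>s t. s \<in> {1..h} \<Longrightarrow> t \<in> {1..h} \<Longrightarrow> s < t \<Longrightarrow> r0 t \<in> Y \<Longrightarrow> r0 s \<in> Y"
    using bij_betw_initial[of "\<mu> ` Y" "\<mu> ` Y \<inter> Y"] finY unfolding card_M
    by (smt (verit, best) Int_iff Int_lower1 bij_betw_apply finite_imageI)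
  \<comment> \<open>Index 0 stands for \<open>T\<close> itself with its missed row and column; index
    \<open>s\<close> of at least 1 stands for the exchange that frees the cell of \<open>T\<close>
    in row \<open>r0 s\<close>.\<close>
  define r where "r s = (if s = 0 then i else r0 s)" for s
  define m where "m s = (if s = 0 then j else \<sigma> (r0 s))" for s
  have r0_M: "r0 s \<in> \<mu> ` Y" if "s \<in> {1..h}" for s using bij_betwE[OF r0] that by blast
  have r0_R: "r0 s \<in> R - {i}" if "s \<in> {1..h}" for s
    using r0_M[OF that] \<mu> by (metis imageE)
  define pre where "pre s = (SOME l. l \<in> Y \<and> r0 s = \<mu> l)" for s
  have pre: "pre s \<in> Y" "r0 s = \<mu> (pre s)" if "s \<in> {1..h}" for s
    using someI_ex[of "\<lambda>l. l \<in> Y \<and> r0 s = \<mu> l"] r0_M[OF that] unfolding pre_def by blast+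
  define N where "N s = insert (i, \<sigma> (pre s)) (insert (pre s, j)
      (T - {(r0 s, \<sigma> (r0 s))} - {(pre s, \<sigma> (pre s))}))" for s
  have N: "rainbow A (N s)" "card (N s) = card T" "N s \<subseteq> R \<times> K" "r0 s \<notin> fst ` N s"
    "\<sigma> (r0 s) \<notin> snd ` N s" if s: "s \<in> {1..h}" for s
  proof -
    let ?x = "r0 s" and ?l = "pre s"
    let ?T = "T - {(?x, \<sigma> ?x)}"
    have x: "?x \<in> R - {i}" and l: "?l \<in> R - {i}" "?x \<noteq> ?l" "A i (\<sigma> ?l) = A ?x (\<sigma> ?x)"
      and ex: "A ?l j \<in> exclusive j"
      using r0_R[OF s] \<mu>[OF pre(1)[OF s]] pre[OF s] unfolding Y_def by auto
    have \<sigma>xl: "\<sigma> ?x \<noteq> \<sigma> ?l" using \<sigma>_inj[OF x l(1)] l(2) by blast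
    have 1: "rainbow A ?T" using rainbow_subset[OF T(2)] by blast
    have 2: "(?l, \<sigma> ?l) \<in> ?T" using \<sigma>[OF l(1)] l(2) by simp
    have 3: "i \<notin> fst ` ?T" "j \<notin> snd ` ?T" using iT jT by auto
    have 4: "A ?l j \<notin> case_prod A ` (?T - {(?l, \<sigma> ?l)})" by (rule excl_notin[OF ex]) auto
    have 5: "A i (\<sigma> ?l) \<notin> case_prod A ` (?T - {(?l, \<sigma> ?l)})"
    proof
      assume "A i (\<sigma> ?l) \<in> case_prod A ` (?T - {(?l, \<sigma> ?l)})"
      then obtain y p where "(y, p) \<in> ?T - {(?l, \<sigma> ?l)}" "A i (\<sigma> ?l) = A y p"
        by (rule case_prod_imageE)
      then have "(y, p) \<in> T" "(y, p) \<noteq> (?x, \<sigma> ?x)" "A y p = A ?x (\<sigma> ?x)"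
        unfolding l(3) by simp_all
      then show False using rainbow_symD[OF T(2) _ \<sigma>[OF x]] by blast
    qed
    have 6: "A ?l j \<noteq> A i (\<sigma> ?l)" using exclusiveD[OF ex i] \<sigma>_K[OF l(1)] by metis
    have 7: "finite ?T" using finT by simp
    show "rainbow A (N s)" unfolding N_def by (rule rainbow_swap(1)[OF 1 2 3 4 5 6 7])
    show "card (N s) = card T"
      using rainbow_swap(2)[OF 1 2 3 4 5 6 7] card_Suc_Diff1[OF finT \<sigma>[OF x]] unfolding N_def by simp
    show "N s \<subseteq> R \<times> K" unfolding N_def using T_RK i j l(1) \<sigma>_K(1)[OF l(1)] by blast
    have "?x \<notin> fst ` ?T" using T_\<sigma> by force
    then show "?x \<notin> fst ` N s" unfolding N_def using x l(2) by auto
    have "\<sigma> ?x \<notin> snd ` ?T" using T_\<sigma> \<sigma>_inj x by force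
    then show "\<sigma> ?x \<notin> snd ` N s" unfolding N_def using \<sigma>xl \<sigma>_K(2)[OF x] by auto
  qed
  define M where "M s = (if s = 0 then T else N s)" for s
  have h_n: "h + 1 \<le> n"
    using card_mono[OF _ Y_R] fin card_R i n_ge unfolding h_def by simp
  have "2 * card (case_prod A ` (R \<times> K)) + 2 * (h + 1) * card R
    \<le> 2 * card R * card K + h * (h + 1) + 2 * h"
  proof (rule card_symbols_bound[where T = T and r = r and m = m and M = M])
    have inj0: "inj_on r0 {1..h}" using r0 by (rule bij_betw_imp_inj_on)
    show "inj_on r {..h}"
    proof (rule inj_onI)
      fix s t assume st: "s \<in> {..h}" "t \<in> {..h}" "r s = r t"
      show "s = t"
        using st r0_R[of s] r0_R[of t] inj_onD[OF inj0, of s t]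
        by (cases "s = 0"; cases "t = 0") (auto simp: r_def)
    qed
    show "inj_on m {..h}"
    proof (rule inj_onI)
      fix s t assume st: "s \<in> {..h}" "t \<in> {..h}" "m s = m t"
      show "s = t"
        using st \<sigma>_K(2)[OF r0_R[of s]] \<sigma>_K(2)[OF r0_R[of t]]
          \<sigma>_inj[OF r0_R[of s] r0_R[of t]] inj_onD[OF inj0, of s t]
        by (cases "s = 0"; cases "t = 0") (auto simp: m_def)
    qed
    show "r ` {..h} \<subseteq> R" using r0_R i by (auto simp: r_def)
    show "m ` {..h} \<subseteq> K" using \<sigma>_K(1)[OF r0_R] j by (auto simp: m_def)
    show "r 0 \<notin> fst ` T" "m 0 \<notin> snd ` T" using iT jT by (simp_all add: r_def m_def)
    show "(r s, m s) \<in> T" if "s \<in> {1..h}" for s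
      using \<sigma>[OF r0_R[OF that]] that by (simp add: r_def m_def)
    show "inj_on snd (M s) \<and> M s \<subseteq> R \<times> K \<and> m s \<notin> snd ` M s" if "s \<le> h" for s
      using that N[of s] inj_snd T_RK jT unfolding M_def m_def by (simp add: rainbow_def)
  next
    fix s x assume s: "s \<le> h" and x: "x \<in> R" "x \<notin> r ` {s<..h}" "(x, m s) \<notin> T" "A x (m s) \<notin> ?Sy"
    have later: "x \<noteq> r0 t" if "t \<in> {s<..h}" for t
      using x(2) that unfolding r_def by force
    show "\<exists>q. (x, q) \<in> M s \<and> q \<notin> m ` {s<..h} \<and> (A (r s) q \<in> ?Sy \<or> A (r s) q = A x (m s))"
    proof (cases "s = 0")
      case True
      have xj: "A x j \<notin> ?Sy" using x(4) True by (simp add: m_def)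
      then have xi: "x \<in> R - {i}" using x(1) ij_Sy by auto
      have "A i (\<sigma> x) \<in> ?Sy \<or> A i (\<sigma> x) = A x j"
      proof (rule ccontr)
        assume c: "\<not> ?thesis"
        have sub: "insert (i, \<sigma> x) (insert (x, j) (T - {(x, \<sigma> x)})) \<subseteq> R \<times> K"
          using T_RK i j xi \<sigma>_K(1)[OF xi] by blast
        have "A x j \<notin> case_prod A ` (T - {(x, \<sigma> x)})" "A i (\<sigma> x) \<notin> case_prod A ` (T - {(x, \<sigma> x)})"
          "A x j \<noteq> A i (\<sigma> x)" using c xj by auto
        then show False
          using rainbow_swap[OF T(2) \<sigma>[OF xi] iT jT] finT no_card[OF sub] by blast
      qed
      moreover have "\<sigma> x \<noteq> m t" if t: "t \<in> {s<..h}" for t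
      proof
        have t1: "t \<in> {1..h}" using t by simp
        assume "\<sigma> x = m t"
        then have "x = r0 t" using \<sigma>_inj[OF xi r0_R[OF t1]] t1 unfolding m_def by simp
        then show False using later[OF t] by blast
      qed
      then have "\<sigma> x \<notin> m ` {s<..h}" by blast
      moreover have "M s = T" "r s = i" "m s = j" using True by (simp_all add: M_def r_def m_def)
      ultimately show ?thesis using \<sigma>[OF xi] by metis
    next
      case False
      then have s1: "s \<in> {1..h}" using s by simp
      note N = N[OF s1]
      let ?y = "r0 s" and ?l = "pre s"
      have rs: "r s = ?y" and ms: "m s = \<sigma> ?y" and Ms: "M s = N s"
        using False by (simp_all add: r_def m_def M_def)
      have y: "?y \<in> R - {i}" and l: "?l \<in> R - {i}" "?l \<in> Y" "A i (\<sigma> ?l) = A ?y (\<sigma> ?y)"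
        and ex: "A ?l j \<in> exclusive j"
        using r0_R[OF s1] \<mu>[OF pre(1)[OF s1]] pre[OF s1] unfolding Y_def by auto
      have x_y: "x \<noteq> ?y" using x(3) \<sigma>[OF y] unfolding ms by blast
      have "\<exists>q. (x, q) \<in> N s \<and> q \<notin> m ` {s<..h}"
      proof -
        have m_later: "m t = \<sigma> (r0 t) \<and> r0 t \<in> R - {i}" if "t \<in> {s<..h}" for t
          using that r0_R[of t] by (simp add: m_def)
        consider "x = i" | "x = ?l" | "x \<in> R - {i}" "x \<noteq> ?l" using x(1) by blast
        then show ?thesis
        proof cases
          case 1
          \<comment> \<open>This is where the order of the enumeration matters. If \<open>?l\<close>
            were freed later, it would be a freed row in \<open>Y\<close>, so \<open>r0 s\<close>
            would lie in \<open>Y\<close> too. Then \<open>Y_Sy\<close> would put the symbol of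
            \<open>(i, m s)\<close> on \<open>T\<close>, against the assumption on
            \<open>(x, m s)\<close>.\<close>
          have "\<sigma> ?l \<noteq> m t" if t: "t \<in> {s<..h}" for t
          proof
            assume "\<sigma> ?l = m t"
            then have "r0 t = ?l" using \<sigma>_inj[OF l(1)] m_later[OF t] by metis
            then have "?y \<in> Y" using r0_Y[of s t] s1 t l(2) by auto
            then show False using x(4) Y_Sy unfolding 1 ms by blast
          qed
          then show ?thesis unfolding 1 N_def by blast
        next
          case 2
          have "j \<noteq> m t" if "t \<in> {s<..h}" for t using m_later[OF that] \<sigma>_K(2) by metis
          then show ?thesis unfolding 2 N_def by blast
        next
          case 3
          have "\<sigma> x \<noteq> m t" if "t \<in> {s<..h}" for t
            using m_later[OF that] \<sigma>_inj[OF 3(1)] later[OF that] by metis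
          moreover have "(x, \<sigma> x) \<in> N s" using \<sigma>[OF 3(1)] 3(2) x_y unfolding N_def by blast
          ultimately show ?thesis by blast
        qed
      qed
      then obtain q where q: "(x, q) \<in> N s" "q \<notin> m ` {s<..h}" by blast
      have "A ?y q \<in> ?Sy \<or> A ?y q = A x (\<sigma> ?y)"
      proof (rule ccontr)
        assume c: "\<not> ?thesis"
        \<comment> \<open>Apart from the exclusive symbol at \<open>(?l, j)\<close>, all symbols of
          \<open>N s\<close> are on \<open>T\<close>. A clash with the exclusive symbol is possible
          only in column \<open>j\<close>; the column \<open>m s\<close> differs from
          \<open>j\<close>, and if \<open>q = j\<close> then \<open>(?l, j)\<close> is the very cell
          removed.\<close>
        have sy: "case_prod A ` (N s - {(?l, j)}) \<subseteq> ?Sy"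
          using Y_Sy[OF l(2)] unfolding N_def by auto
        have qK: "q \<in> K" using q(1) N(3) by auto
        have xK: "A x (\<sigma> ?y) \<noteq> A ?l j"
          using exclusiveD[OF ex x(1) \<sigma>_K(1)[OF y]] \<sigma>_K(2)[OF y] by metis
        have sy': "v \<in> ?Sy \<or> v = A ?l j" if "v \<in> case_prod A ` (N s - {(x, q)})" for v
          using that
        proof (rule case_prod_imageE)
          fix a b assume ab: "(a, b) \<in> N s - {(x, q)}" "v = A a b"
          then show ?thesis
            using sy case_prod_imageI[of a b "N s - {(?l, j)}" A] by (cases "(a, b) = (?l, j)") auto
        qed
        have a: "A x (\<sigma> ?y) \<notin> case_prod A ` (N s - {(x, q)})"
          using x(4) sy' xK unfolding ms by blast
        have b: "A ?y q \<notin> case_prod A ` (N s - {(x, q)})"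
        proof (cases "q = j")
          case True
          then have "x = ?l" using rainbow_sndD[OF N(1)] q(1) unfolding N_def by blast
          then show ?thesis using c sy True by blast
        next
          case False
          then have "A ?y q \<noteq> A ?l j" using exclusiveD[OF ex _ qK] y by blast
          then show ?thesis using c sy' by blast
        qed
        have sub: "insert (?y, q) (insert (x, \<sigma> ?y) (N s - {(x, q)})) \<subseteq> R \<times> K"
          using N(3) y x(1) qK \<sigma>_K(1)[OF y] by blast
        have "A x (\<sigma> ?y) \<noteq> A ?y q" using c by metis
        then show False
          using rainbow_swap[OF N(1) q(1) N(4,5) a b _ finite_subset_RK[OF N(3)]] no_card[OF sub] N(2)
          by simp
      qed
      then show ?thesis using q unfolding rs ms Ms by blast
    qed
  qed (use fin T_RK T(2) in auto)
  then have "2 * card (case_prod A ` (R \<times> K)) + 2 * (h + 1) * n \<le> 2 * n * n + h * (h + 1) + 2 * h"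
    unfolding card_R card_K .
  moreover have "(3 - sqrt 5) / 2 * real n + (sqrt 5 - 1) / 4 \<le> real h"
    using many_excl card_Y unfolding h_def by simp
  ultimately show False using numeric_contradiction[OF many] h_n by blast
qed

section \<open>Partial transversals in the columns without singletons\<close>

definition singleton_cols :: "'k set" where
  "singleton_cols = {j \<in> K. \<exists>i. singleton i j}"

text \<open>This excludes a violation \<open>S\<close> of Hall's condition, with \<open>f\<close> a
  column outside its neighbourhood. Each row of \<open>S\<close> accounts for many lost symbols that
  lie in column \<open>f\<close> without being exclusive to it. These sets of symbols are disjoint
  for different rows, and column \<open>f\<close> has no room for them.\<close>

lemma few_blocked_rows:
  assumes f: "f \<in> K" and S: "S \<subseteq> R" "S \<noteq> {}"
    and blocked: "\<And>i. i \<in> S \<Longrightarrow> blocked i f"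
    and excl: "\<And>i. i \<in> S \<Longrightarrow> A i f \<notin> exclusive f"
    and few: "\<And>i. i \<in> S \<Longrightarrow> card {p. singleton i p} < card S"
  shows False
proof -
  define e where "e = card (exclusive f)"
  define q where "q = card S"
  define D where "D i = lost i f - exclusive f - A i ` {p. singleton i p}" for i
  have finS: "finite S" using S fin finite_subset by blast
  have q1: "1 \<le> q" unfolding q_def using S(2) finS by (simp add: Suc_leI card_gt_0_iff)
  have "exclusive f \<subseteq> (\<lambda>x. A x f) ` (R - S)" using excl unfolding exclusive_def by blast
  then have "e \<le> card (R - S)" unfolding e_def using fin by (intro surj_card_le) auto
  also have "\<dots> = n - q" unfolding q_def using S(1) finS card_R by (simp add: card_Diff_subset)
  finally have "e \<le> n - q" .
  moreover have "q \<le> n" unfolding q_def using S(1) fin card_R card_mono by metis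
  ultimately have eq: "e + q \<le> n" by linarith
  have D_occ: "v \<in> (\<lambda>x. A x f) ` R - exclusive f \<and> (\<exists>p\<in>K. p \<noteq> f \<and> A i p = v)"
    if i: "i \<in> S" and v: "v \<in> D i" for i v
  proof -
    have only: "y = i \<or> p = f" if "y \<in> R" "p \<in> K" "A y p = v" for y p
      using v that case_prod_imageI[of y p "(R - {i}) \<times> (K - {f})" A]
      unfolding D_def lost_def by auto
    obtain y p where yp: "y \<in> R" "p \<in> K" "A y p = v"
      using v unfolding D_def lost_def by auto
    \<comment> \<open>Outside column \<open>f\<close> the symbol is confined to row
      \<open>i\<close>, where it occurs once. If it also avoided column \<open>f\<close>, it would
      belong to a singleton of row \<open>i\<close>, and those are removed from
      \<open>D i\<close>.\<close>
    have col: "v \<in> (\<lambda>x. A x f) ` R"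
    proof (rule ccontr)
      assume c: "v \<notin> (\<lambda>x. A x f) ` R"
      have "y' = i" "p' = p" if "y' \<in> R" "p' \<in> K" "A y' p' = v" for y' p'
      proof -
        show "y' = i" using only[OF that] c that by blast
        moreover have "y = i" using only[OF yp] c yp by blast
        moreover have "i \<in> R" using \<open>y = i\<close> yp by simp
        ultimately show "p' = p" using that yp rowD[of i p' p] by simp
      qed
      then have "singleton i p" using yp unfolding singleton_def by metis
      moreover have "A i p = v" using only[OF yp] yp c by blast
      ultimately show False using v unfolding D_def by blast
    qed
    have "v \<notin> exclusive f" using v unfolding D_def by blast
    then have "v \<in> case_prod A ` (R \<times> (K - {f}))" using col unfolding exclusive_def by blast
    then obtain x p where "x \<in> R" "p \<in> K" "p \<noteq> f" "v = A x p" by (elim case_prod_imageE) auto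
    then show ?thesis using only[of x p] col \<open>v \<notin> exclusive f\<close> by blast
  qed
  have disj: "D i \<inter> D i' = {}" if ii: "i \<in> S" "i' \<in> S" "i \<noteq> i'" for i i'
  proof (rule ccontr)
    assume "D i \<inter> D i' \<noteq> {}"
    then obtain v where v: "v \<in> D i" "v \<in> D i'" by blast
    obtain p where "p \<in> K" "p \<noteq> f" "A i p = v" using D_occ[OF ii(1) v(1)] by blast
    then have "v \<in> case_prod A ` ((R - {i'}) \<times> (K - {f}))"
      using case_prod_imageI[of i p "(R - {i'}) \<times> (K - {f})" A] ii S(1) by auto
    then show False using v(2) unfolding D_def lost_def by blast
  qed
  have fin_excl: "finite (exclusive f)" and sub_excl: "exclusive f \<subseteq> (\<lambda>x. A x f) ` R"
    using fin unfolding exclusive_def by auto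
  have finD: "finite (D i)" for i using fin unfolding D_def lost_def by auto
  have "(\<Sum>i\<in>S. card (D i)) = card (\<Union>i\<in>S. D i)"
    by (rule card_UN_disjoint[symmetric]) (use finS finD disj in auto)
  also have "\<dots> \<le> card ((\<lambda>x. A x f) ` R - exclusive f)"
    by (rule card_mono) (use D_occ fin in auto)
  also have "\<dots> = card ((\<lambda>x. A x f) ` R) - e"
    unfolding e_def by (rule card_Diff_subset[OF fin_excl sub_excl])
  also have "\<dots> \<le> n - e" using card_image_le[OF fin(1), of "\<lambda>x. A x f"] card_R by simp
  finally have sum: "(\<Sum>i\<in>S. card (D i)) \<le> n - e" .
  \<comment> \<open>The 2 collects two strict inequalities: more than \<open>n\<close> symbols are
    lost, and row \<open>i\<close> has fewer than \<open>q\<close> singletons.\<close>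
  have each: "n + 2 \<le> card (D i) + e + q" if i: "i \<in> S" for i
  proof -
    have fin_s: "finite {p. singleton i p}"
      by (rule finite_subset[OF _ fin(2)]) (auto simp: singleton_def)
    have "lost i f \<subseteq> D i \<union> (exclusive f \<union> A i ` {p. singleton i p})" unfolding D_def by blast
    then have "card (lost i f) \<le> card (D i \<union> (exclusive f \<union> A i ` {p. singleton i p}))"
      using finD fin_excl fin_s by (intro card_mono) auto
    also have "\<dots> \<le> card (D i) + card (exclusive f \<union> A i ` {p. singleton i p})" by (rule card_Un_le)
    also have "card (exclusive f \<union> A i ` {p. singleton i p}) \<le> e + card (A i ` {p. singleton i p})"
      unfolding e_def by (rule card_Un_le)
    also have "card (A i ` {p. singleton i p}) \<le> card {p. singleton i p}"
      by (rule card_image_le[OF fin_s])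
    finally have 1: "card (lost i f) + 1 \<le> card (D i) + e + q"
      using few[OF i] unfolding q_def by linarith
    have "real n \<le> (5 - sqrt 5) / 4 * (2 * real n - 1)"
    proof -
      have q3: "sqrt 5 < 9 / 4" by (rule real_less_lsqrt) (auto simp: power2_eq_square)
      have "real n \<le> 11 / 16 * (2 * real n - 1)" using n_ge by simp
      also have "\<dots> \<le> (5 - sqrt 5) / 4 * (2 * real n - 1)"
        using q3 n_ge by (intro mult_right_mono) auto
      finally show ?thesis .
    qed
    then have "real n < real (card (lost i f))"
      using card_lost[OF _ f blocked[OF i]] i S(1) by force
    then show ?thesis using 1 by linarith
  qed
  have "q * (n + 2) \<le> (\<Sum>i\<in>S. card (D i) + e + q)"
    using sum_mono[of S "\<lambda>_. n + 2", OF each] unfolding q_def by simp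
  also have "\<dots> = (\<Sum>i\<in>S. card (D i)) + q * (e + q)"
    unfolding q_def by (simp add: sum.distrib algebra_simps)
  also have "\<dots> \<le> (n - e) + q * (e + q)" using sum by simp
  finally have 2: "q * (n + 2) \<le> (n - e) + q * (e + q)" .
  \<comment> \<open>In terms of \<open>d\<close> the inequality reads
    \<open>q * d + 2 * q \<le> q + d\<close>, impossible for \<open>q\<close> at least 1.\<close>
  obtain d where d: "n = e + q + d" using eq le_Suc_ex by blast
  have "q * (e + q) + q * d + 2 * q \<le> q + d + q * (e + q)" using 2 unfolding d by (simp add: algebra_simps)
  moreover have "d \<le> q * d" using q1 by simp
  ultimately show False using q1 by linarith
qed

text \<open>If \<open>T\<close> covered all the other columns, the rows it misses would be as many
  as the columns with singletons. Hall's theorem, with \<open>i\<close> joined to \<open>f\<close>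
  when the symbol of \<open>(i, f)\<close> is exclusive to \<open>f\<close>, would match them.
  Exclusive symbols of distinct columns clash neither with each other nor with \<open>T\<close>, so
  a full transversal would result.\<close>

lemma no_cover_of_other_columns:
  assumes blocked: "\<And>i j. i \<in> R \<Longrightarrow> j \<in> singleton_cols \<Longrightarrow> blocked i j"
    and T: "T \<subseteq> R \<times> (K - singleton_cols)" "rainbow A T"
  shows "card T < card (K - singleton_cols)"
proof (rule ccontr)
  let ?C = "singleton_cols" and ?B = "K - singleton_cols"
  assume "\<not> card T < card ?B"
  have CK: "?C \<subseteq> K" unfolding singleton_cols_def by auto
  have T_RK: "T \<subseteq> R \<times> K" using T(1) by auto
  have finT: "finite T" by (rule finite_subset_RK[OF T_RK])
  have inj: "inj_on fst T" "inj_on snd T" using T(2) unfolding rainbow_def by auto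
  have "card T = card (snd ` T)" using card_image[OF inj(2)] by simp
  also have "\<dots> \<le> card ?B" using T(1) fin by (intro card_mono) auto
  finally have card_T: "card T = card ?B" using \<open>\<not> card T < card ?B\<close> by simp
  define W where "W = R - fst ` T"
  have finW: "finite W" and W_R: "W \<subseteq> R" using fin unfolding W_def by auto
  have finC: "finite ?C" using CK fin finite_subset by blast
  have "card W = n - card T"
    unfolding W_def using T(1) finT card_R card_image[OF inj(1)]
    by (subst card_Diff_subset) auto
  also have "card T = n - card ?C" using card_T CK finC card_K by (simp add: card_Diff_subset)
  finally have card_W: "card W = card ?C" using card_mono[OF fin(2) CK] card_K by simp
  define N where "N i = {f \<in> ?C. A i f \<in> exclusive f}" for i
  have "card S \<le> card (\<Union>(N ` S))" if S: "S \<subseteq> W" for S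
  proof (rule ccontr)
    assume c: "\<not> card S \<le> card (\<Union>(N ` S))"
    have NC: "\<Union>(N ` S) \<subseteq> ?C" unfolding N_def by auto
    have "card S \<le> card ?C" using card_mono[OF finW S] card_W by simp
    then have "\<Union>(N ` S) \<noteq> ?C" using c by auto
    then obtain f where f: "f \<in> ?C" "f \<notin> \<Union>(N ` S)" using NC by blast
    show False
    proof (rule few_blocked_rows)
      show "f \<in> K" using f CK by blast
      show "S \<subseteq> R" using S W_R by blast
      show "S \<noteq> {}" using c by auto
      show "blocked i f" if "i \<in> S" for i using blocked f(1) that S W_R by blast
      show "A i f \<notin> exclusive f" if "i \<in> S" for i using f that unfolding N_def by blast
      show "card {p. singleton i p} < card S" if "i \<in> S" for i
      proof -
        \<comment> \<open>Singletons carry exclusive symbols, so their columns are neighbours of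
          \<open>i\<close>; a violating \<open>S\<close> has fewer neighbours than elements.\<close>
        have "{p. singleton i p} \<subseteq> N i"
          using singleton_exclusive unfolding N_def singleton_cols_def by (auto simp: singleton_def)
        then have "{p. singleton i p} \<subseteq> \<Union>(N ` S)" using that by blast
        then have "card {p. singleton i p} \<le> card (\<Union>(N ` S))"
          using finite_subset[OF NC finC] by (intro card_mono)
        then show ?thesis using c by linarith
      qed
    qed
  qed
  moreover have "\<forall>i\<in>W. finite (N i)" using finC unfolding N_def by auto
  ultimately obtain g where g: "inj_on g W" "\<forall>i\<in>W. g i \<in> N i"
    using hall[OF finW, of N] by blast
  let ?G = "(\<lambda>i. (i, g i)) ` W"
  have gC: "g i \<in> ?C" "A i (g i) \<in> exclusive (g i)" if "i \<in> W" for i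
    using g(2) that unfolding N_def by auto
  have disj: "T \<inter> ?G = {}" unfolding W_def by force
  have G_excl: "A x p \<noteq> A i (g i)" if "i \<in> W" "x \<in> R" "p \<in> K" "p \<noteq> g i" for i x p
    using exclusiveD[OF gC(2)[OF that(1)] that(2,3)] that(4) by metis
  have "rainbow A (T \<union> ?G)"
    unfolding rainbow_def
  proof (intro conjI)
    have "inj_on fst ?G" by (auto simp: inj_on_def)
    moreover have "fst ` ?G = W" by force
    then have "fst ` T \<inter> fst ` ?G = {}" unfolding W_def by blast
    ultimately show "inj_on fst (T \<union> ?G)" unfolding inj_on_Un using inj(1) by blast
    have "inj_on snd ?G" using g(1) by (auto simp: inj_on_def)
    moreover have "snd ` T \<inter> snd ` ?G = {}" using T(1) gC(1) by auto
    ultimately show "inj_on snd (T \<union> ?G)" unfolding inj_on_Un using inj(2) by blast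
    have "inj_on (case_prod A) ?G"
    proof (rule inj_onI)
      fix a b assume "a \<in> ?G" "b \<in> ?G" and eq: "case_prod A a = case_prod A b"
      then obtain i k where ik: "i \<in> W" "a = (i, g i)" "k \<in> W" "b = (k, g k)" by blast
      have "g i = g k" using G_excl[OF ik(3), of i "g i"] eq ik gC(1) CK W_R by auto
      then show "a = b" using g(1) ik by (auto dest: inj_onD)
    qed
    moreover have "case_prod A ` T \<inter> case_prod A ` ?G = {}"
    proof -
      have "A x p \<noteq> A i (g i)" if "(x, p) \<in> T" "i \<in> W" for x p i
        using G_excl[OF that(2), of x p] that T(1) gC(1)[OF that(2)] by blast
      then show ?thesis by fastforce
    qed
    ultimately show "inj_on (case_prod A) (T \<union> ?G)"
      unfolding inj_on_Un using T(2) unfolding rainbow_def by blast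
  qed
  moreover have "T \<union> ?G \<subseteq> R \<times> K" using T_RK W_R gC(1) CK by auto
  moreover have "card (T \<union> ?G) = n"
  proof -
    have "card ?G = card W" by (rule card_image) (auto simp: inj_on_def)
    then have "card (T \<union> ?G) = card T + card W" using card_Un_disjoint[OF finT _ disj] finW by simp
    then show ?thesis using card_T card_W CK finC card_K card_mono[OF fin(2) CK]
      by (simp add: card_Diff_subset)
  qed
  ultimately show False using no_transversal by blast
qed

definition rotations :: "('r \<times> 'k) set \<Rightarrow> 'k set \<Rightarrow> 'k \<Rightarrow> nat \<Rightarrow>
    (nat \<Rightarrow> 'r) \<Rightarrow> (nat \<Rightarrow> 'k) \<Rightarrow> (nat \<Rightarrow> ('r \<times> 'k) set) \<Rightarrow> 'r set \<Rightarrow> bool" where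
  "rotations T B j h r m M V \<longleftrightarrow>
    m 0 = j \<and> M 0 = T \<and> inj_on m {..h} \<and> V \<subseteq> R - fst ` T \<and> card V \<le> h \<and>
    (\<forall>s\<in>{1..h}. (r s, m s) \<in> T \<and> r s \<notin> fst ` M s) \<and>
    (\<forall>s\<le>h. rainbow A (M s) \<and> M s \<subseteq> R \<times> B \<and> card (M s) = card T \<and>
      case_prod A ` M s = case_prod A ` T \<and> m s \<notin> snd ` M s \<and>
      (\<forall>z\<in>T. snd z \<notin> m ` {1..s} \<longrightarrow> z \<in> M s) \<and> fst ` M s \<subseteq> fst ` T \<union> V)"

text \<open>Each row \<open>u\<close> missed by \<open>T\<close> yields one further column: among the \<open>h + 1\<close> distinct symbols
  of row \<open>u\<close> in the columns \<open>m 0, \<dots>, m h\<close> one is not a symbol of \<open>T\<close> in \<open>m 1, \<dots>, m h\<close>.\<close>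

lemma rotations_exist:
  assumes T: "T \<subseteq> R \<times> B" "rainbow A T" and B: "B \<subseteq> K" and j: "j \<in> B" "j \<notin> snd ` T"
    and maximal: "\<And>T'. T' \<subseteq> R \<times> B \<Longrightarrow> rainbow A T' \<Longrightarrow> card T' \<le> card T"
  shows "h \<le> card (R - fst ` T) \<Longrightarrow> \<exists>r m M V. rotations T B j h r m M V"
proof (induction h)
  case 0
  have "rotations T B j 0 (\<lambda>_. undefined) (\<lambda>_. j) (\<lambda>_. T) {}"
    using T j unfolding rotations_def by simp
  then show ?case by blast
next
  case (Suc h)
  let ?Sy = "case_prod A ` T"
  obtain r m M V where rot: "rotations T B j h r m M V" using Suc by auto
  then have m0: "m 0 = j" and M0: "M 0 = T" and inj_m: "inj_on m {..h}"
    and V: "V \<subseteq> R - fst ` T" "card V \<le> h"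
    and rm: "\<And>s. s \<in> {1..h} \<Longrightarrow> (r s, m s) \<in> T \<and> r s \<notin> fst ` M s"
    and M: "\<And>s. s \<le> h \<Longrightarrow> rainbow A (M s) \<and> M s \<subseteq> R \<times> B \<and> card (M s) = card T \<and>
      case_prod A ` M s = ?Sy \<and> m s \<notin> snd ` M s \<and>
      (\<forall>z\<in>T. snd z \<notin> m ` {1..s} \<longrightarrow> z \<in> M s) \<and> fst ` M s \<subseteq> fst ` T \<union> V"
    unfolding rotations_def by auto
  have T_RK: "T \<subseteq> R \<times> K" using T(1) B by auto
  have "V \<noteq> R - fst ` T" using V(2) Suc.prems by auto
  then obtain u where u: "u \<in> R" "u \<notin> fst ` T" "u \<notin> V" using V(1) by blast
  have mB: "m s \<in> B" if "s \<le> h" for s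
  proof (cases "s = 0")
    case False
    then show ?thesis using rm[of s] that T(1) by auto
  qed (use m0 j in simp)
  have u_Ms: "u \<notin> fst ` M s" if "s \<le> h" for s using M[OF that] u by blast
  \<comment> \<open>Otherwise \<open>(u, m s)\<close> could be added to \<open>M s\<close>, which
    has the symbols of \<open>T\<close> and misses both \<open>u\<close> and
    \<open>m s\<close>.\<close>
  have u_Sy: "A u (m s) \<in> ?Sy" if s: "s \<le> h" for s
  proof (rule ccontr)
    assume "A u (m s) \<notin> ?Sy"
    then have "rainbow A (insert (u, m s) (M s))"
      using M[OF s] u_Ms[OF s] by (intro rainbow_insert) auto
    moreover have "insert (u, m s) (M s) \<subseteq> R \<times> B" using M[OF s] u(1) mB[OF s] by auto
    moreover have "card (insert (u, m s) (M s)) = Suc (card T)"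
    proof -
      have "finite (M s)" using M[OF s] B by (intro finite_subset_RK) auto
      moreover have "(u, m s) \<notin> M s" using u_Ms[OF s] by force
      ultimately show ?thesis using M[OF s] by simp
    qed
    ultimately show False using maximal[of "insert (u, m s) (M s)"] by simp
  qed
  have "\<exists>s\<le>h. A u (m s) \<notin> (\<lambda>s. A (r s) (m s)) ` {1..h}"
  proof (rule ccontr)
    assume c: "\<not> ?thesis"
    have "inj_on (\<lambda>s. A u (m s)) {..h}"
    proof (rule inj_onI)
      fix s t assume st: "s \<in> {..h}" "t \<in> {..h}" "A u (m s) = A u (m t)"
      then have "m s = m t" using rowD[OF u(1)] mB B by auto
      then show "s = t" using inj_m st by (auto dest: inj_onD)
    qed
    then have "card {..h} \<le> card ((\<lambda>s. A (r s) (m s)) ` {1..h})"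
      using c by (intro card_inj_on_le) auto
    also have "\<dots> \<le> card {1..h}" by (rule card_image_le) simp
    finally show False by simp
  qed
  then obtain s where s: "s \<le> h" and new: "A u (m s) \<notin> (\<lambda>s. A (r s) (m s)) ` {1..h}" by blast
  obtain x p where xp: "(x, p) \<in> T" "A u (m s) = A x p" using u_Sy[OF s] by (elim case_prod_imageE)
  have p_new: "p \<noteq> m t" if t: "t \<le> h" for t
  proof
    assume p: "p = m t"
    show False
    proof (cases "t = 0")
      case True
      then show False using p m0 j(2) xp(1) by force
    next
      case False
      then have "(r t, p) \<in> T" using rm[of t] t p by simp
      then have "x = r t" using rainbow_sndD[OF T(2) xp(1)] by blast
      then show False using new p xp(2) False t by auto
    qed
  qed
  have Ms: "rainbow A (M s)" "M s \<subseteq> R \<times> B" "card (M s) = card T" "case_prod A ` M s = ?Sy"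
    "m s \<notin> snd ` M s" "fst ` M s \<subseteq> fst ` T \<union> V"
    and keep: "\<And>z. z \<in> T \<Longrightarrow> snd z \<notin> m ` {1..s} \<Longrightarrow> z \<in> M s"
    using M[OF s] by auto
  have finM: "finite (M s)" using Ms(2) B by (intro finite_subset_RK) auto
  have xpM: "(x, p) \<in> M s" 
  proof (rule keep[OF xp(1)])
    have "p \<noteq> m t" if "t \<in> {1..s}" for t using p_new[of t] s that by simp
    then show "snd (x, p) \<notin> m ` {1..s}" unfolding snd_conv by blast
  qed
  \<comment> \<open>The cells \<open>(u, m s)\<close> and \<open>(x, p)\<close> carry the same
    symbol, so the exchange keeps the set of symbols while it frees row \<open>x\<close> and the new
    column \<open>p\<close>. It starts from \<open>M s\<close>, which need not be the most recent
    \<open>M h\<close>.\<close>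
  define M' where "M' = insert (u, m s) (M s - {(x, p)})"
  have um: "(u, m s) \<notin> M s - {(x, p)}" using u_Ms[OF s] by force
  have sy_eq: "case_prod A ` M' = ?Sy"
  proof -
    have "case_prod A ` M' = insert (A x p) (case_prod A ` (M s - {(x, p)}))"
      unfolding M'_def using xp(2) by simp
    also have "\<dots> = case_prod A ` (insert (x, p) (M s - {(x, p)}))"
      by (simp only: image_insert case_prod_conv)
    also have "insert (x, p) (M s - {(x, p)}) = M s" using xpM by blast
    finally show ?thesis using Ms(4) by simp
  qed
  have "rainbow A M'"
    unfolding M'_def
  proof (rule rainbow_insert)
    show "rainbow A (M s - {(x, p)})" using rainbow_subset[OF Ms(1)] by blast
    show "u \<notin> fst ` (M s - {(x, p)})" "m s \<notin> snd ` (M s - {(x, p)})"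
      using u_Ms[OF s] Ms(5) by blast+
    show "A u (m s) \<notin> case_prod A ` (M s - {(x, p)})"
    proof
      assume "A u (m s) \<in> case_prod A ` (M s - {(x, p)})"
      then obtain y q where "(y, q) \<in> M s - {(x, p)}" "A u (m s) = A y q" by (rule case_prod_imageE)
      then show False using rainbow_symD[OF Ms(1) xpM, of y q] xp(2) by auto
    qed
  qed
  moreover have "M' \<subseteq> R \<times> B" unfolding M'_def using Ms(2) u(1) mB[OF s] by auto
  moreover have "card M' = card T"
    unfolding M'_def using um finM card_Suc_Diff1[OF finM xpM] Ms(3) by simp
  moreover have "p \<notin> snd ` M'"
    unfolding M'_def using p_new[OF s] rainbow_sndD[OF Ms(1) xpM] by fastforce
  moreover have "x \<notin> fst ` M'"
  proof -
    have "x \<noteq> u" using xp(1) u(2) by force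
    then show ?thesis unfolding M'_def using rainbow_fstD[OF Ms(1) xpM] by fastforce
  qed
  moreover have "z \<in> M'" if z: "z \<in> T" "snd z \<notin> insert p (m ` {1..h})" for z
  proof -
    have "m ` {1..s} \<subseteq> m ` {1..h}" using s by (intro image_mono) simp
    then have "z \<in> M s" using keep[OF z(1)] z(2) by blast
    then show ?thesis using z(2) unfolding M'_def by auto
  qed
  moreover have "fst ` M' \<subseteq> fst ` T \<union> insert u V" unfolding M'_def using Ms(6) by auto
  ultimately have M': "rainbow A M' \<and> M' \<subseteq> R \<times> B \<and> card M' = card T \<and> case_prod A ` M' = ?Sy \<and>
      p \<notin> snd ` M' \<and> (\<forall>z\<in>T. snd z \<notin> insert p (m ` {1..h}) \<longrightarrow> z \<in> M') \<and>
      fst ` M' \<subseteq> fst ` T \<union> insert u V" and xM': "x \<notin> fst ` M'"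
    using sy_eq by blast+
  let ?r = "r(Suc h := x)" and ?m = "m(Suc h := p)" and ?M = "M(Suc h := M')"
  have "inj_on ?m {..Suc h}"
  proof -
    have "inj_on ?m {..h}" using inj_m by (auto simp: inj_on_def)
    moreover have "?m (Suc h) \<notin> ?m ` {..h}" using p_new by auto
    ultimately show ?thesis unfolding atMost_Suc by (auto simp: inj_on_insert)
  qed
  moreover have "card (insert u V) \<le> Suc h" using V(2) by (simp add: card_insert_le_m1 card_insert_if)
  moreover have "(?r t, ?m t) \<in> T \<and> ?r t \<notin> fst ` ?M t" if "t \<in> {1..Suc h}" for t
    using rm[of t] xp(1) xM' that by (cases "t = Suc h") auto
  moreover have "rainbow A (?M t) \<and> ?M t \<subseteq> R \<times> B \<and> card (?M t) = card T \<and>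
      case_prod A ` ?M t = ?Sy \<and> ?m t \<notin> snd ` ?M t \<and>
      (\<forall>z\<in>T. snd z \<notin> ?m ` {1..t} \<longrightarrow> z \<in> ?M t) \<and> fst ` ?M t \<subseteq> fst ` T \<union> insert u V"
    if t: "t \<le> Suc h" for t
  proof (cases "t = Suc h")
    case True
    have "?m ` {1..Suc h} = insert p (m ` {1..h})" by (auto simp: atLeastAtMostSuc_conv)
    then show ?thesis using M' True by simp
  next
    case False
    then have "t \<le> h" using t by simp
    moreover from this have "?m ` {1..t} = m ` {1..t}" by auto
    ultimately show ?thesis using M[of t] by auto
  qed
  ultimately have "rotations T B j (Suc h) ?r ?m ?M (insert u V)"
    using m0 M0 V(1) u unfolding rotations_def by auto
  then show ?case by blast
qed

text \<open>A largest \<open>T\<close> in the columns without singletons leaves one of them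
  uncovered, so it misses at least one row more than there are columns with singletons. Each missed
  row pays for one exchange, and that extra 1 covers the additive constant
  \<open>(sqrt 5 - 1) / 4\<close> of the numeric threshold.\<close>

lemma all_blocked_false:
  assumes blocked: "\<And>i j. i \<in> R \<Longrightarrow> j \<in> singleton_cols \<Longrightarrow> blocked i j"
  shows False
proof -
  define B where "B = K - singleton_cols"
  have BK: "B \<subseteq> K" and CK: "singleton_cols \<subseteq> K" unfolding B_def singleton_cols_def by auto
  define P where "P T \<longleftrightarrow> T \<subseteq> R \<times> B \<and> rainbow A T" for T
  have less: "card T < card B" if "P T" for T
    using no_cover_of_other_columns[OF blocked] that unfolding P_def B_def by blast
  have "P {}" unfolding P_def rainbow_def by simp
  then obtain T where T: "P T" and maximal: "\<And>T'. P T' \<Longrightarrow> card T' \<le> card T"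
    using ex_has_greatest_nat[of P "{}" card "card B"] less by (metis less_imp_le)
  have T_RB: "T \<subseteq> R \<times> B" and rain: "rainbow A T" using T unfolding P_def by auto
  have T_RK: "T \<subseteq> R \<times> K" using T_RB BK by auto
  have finT: "finite T" by (rule finite_subset_RK[OF T_RK])
  have inj: "inj_on fst T" "inj_on snd T" using rain unfolding rainbow_def by auto
  let ?Sy = "case_prod A ` T"
  have "card (snd ` T) < card B" using less[OF T] card_image[OF inj(2)] by simp
  then have "snd ` T \<noteq> B" by auto
  then obtain j where j: "j \<in> B" "j \<notin> snd ` T" using T_RB by auto
  define h where "h = card (R - fst ` T)"
  have h_eq: "h = n - card T"
    unfolding h_def using T_RK finT card_R card_image[OF inj(1)] by (subst card_Diff_subset) auto
  have card_B: "card B + card singleton_cols = n"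
    unfolding B_def using CK card_K fin card_mono[OF fin(2) CK] finite_subset[OF CK fin(2)]
    by (simp add: card_Diff_subset)
  have h_ge: "card singleton_cols + 1 \<le> h" using h_eq card_B less[OF T] by linarith
  have "\<exists>r m M V. rotations T B j h r m M V"
    by (rule rotations_exist[OF T_RB rain BK j])
      (use maximal in \<open>auto simp: P_def h_def\<close>)
  then obtain r m M V where "rotations T B j h r m M V" by blast
  then have m0: "m 0 = j" and M0: "M 0 = T" and inj_m: "inj_on m {..h}"
    and rm: "\<And>s. s \<in> {1..h} \<Longrightarrow> (r s, m s) \<in> T \<and> r s \<notin> fst ` M s"
    and M: "\<And>s. s \<le> h \<Longrightarrow> rainbow A (M s) \<and> M s \<subseteq> R \<times> B \<and> card (M s) = card T \<and>
      case_prod A ` M s = ?Sy \<and> m s \<notin> snd ` M s \<and>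
      (\<forall>z\<in>T. snd z \<notin> m ` {1..s} \<longrightarrow> z \<in> M s)"
    unfolding rotations_def by auto
  obtain u where u: "u \<in> R" "u \<notin> fst ` T"
    using h_ge unfolding h_def by (metis Diff_iff all_not_in_conv card.empty le_zero_eq add_is_0 zero_neq_one)
  \<comment> \<open>Any row missed by \<open>T\<close> can serve for index 0, which
    \<open>rotations\<close> leaves open.\<close>
  define \<rho> where "\<rho> = r(0 := u)"
  have \<rho>: "\<rho> s \<in> R" "\<rho> s \<notin> fst ` M s" if "s \<le> h" for s
    using rm[of s] that u M0 T_RK unfolding \<rho>_def by (auto split: if_splits)
  have \<rho>T: "(\<rho> s, m s) \<in> T" if "s \<in> {1..h}" for s using rm[OF that] that unfolding \<rho>_def by auto
  have mB: "m s \<in> B" if "s \<le> h" for s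
    using rm[of s] that j m0 T_RB by (cases "s = 0") auto
  \<comment> \<open>The columns \<open>m 1\<close> to \<open>m h\<close> are distinct columns
    covered by \<open>T\<close>, which gives \<open>h \<le> card T < n\<close>.\<close>
  have "h = card (m ` {1..h})" using inj_m card_image[of m "{1..h}"] by (simp add: inj_on_def)
  also have "\<dots> \<le> card (snd ` T)" using rm finT by (intro card_mono) force+
  also have "\<dots> = card T" using card_image[OF inj(2)] .
  finally have h_n: "h + 1 \<le> n" using less[OF T] card_B by linarith
  have "2 * card (case_prod A ` (R \<times> K)) + 2 * (h + 1) * card R
    \<le> 2 * card R * card K + h * (h + 1) + 2 * h"
  proof (rule card_symbols_bound[where T = T and r = \<rho> and m = m and M = M])
    show "inj_on \<rho> {..h}"
    proof (rule inj_onI)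
      fix s t assume st: "s \<in> {..h}" "t \<in> {..h}" "\<rho> s = \<rho> t"
      have ne: "u \<noteq> \<rho> a" if "a \<in> {1..h}" for a using \<rho>T[OF that] u(2) by force
      have u0: "\<rho> 0 = u" unfolding \<rho>_def by simp
      show "s = t"
      proof (cases "s = 0 \<or> t = 0")
        case True
        then show ?thesis using st u0 ne[of s] ne[of t] by (cases "s = 0"; cases "t = 0") auto
      next
        case False
        then have "m s = m t" using st \<rho>T[of s] \<rho>T[of t] rainbow_fstD[OF rain] by auto
        then show ?thesis using inj_m st by (auto dest: inj_onD)
      qed
    qed
    show "\<rho> ` {..h} \<subseteq> R" "m ` {..h} \<subseteq> K" using \<rho>(1) mB BK by auto
    show "\<rho> 0 \<notin> fst ` T" "m 0 \<notin> snd ` T" using u(2) j(2) m0 by (simp_all add: \<rho>_def)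
    show "inj_on snd (M s) \<and> M s \<subseteq> R \<times> K \<and> m s \<notin> snd ` M s" if "s \<le> h" for s
      using M[OF that] BK unfolding rainbow_def by blast
  next
    fix s x assume s: "s \<le> h" and x: "x \<in> R" "x \<notin> \<rho> ` {s<..h}" "(x, m s) \<notin> T" "A x (m s) \<notin> ?Sy"
    have Ms: "rainbow A (M s)" "M s \<subseteq> R \<times> B" "card (M s) = card T" "case_prod A ` M s = ?Sy"
      "m s \<notin> snd ` M s" and keep: "\<And>z. z \<in> T \<Longrightarrow> snd z \<notin> m ` {1..s} \<Longrightarrow> z \<in> M s"
      using M[OF s] by auto
    have finM: "finite (M s)" using Ms(2) BK by (intro finite_subset_RK) auto
    have "x \<in> fst ` M s"
    proof (rule ccontr)
      assume c: "x \<notin> fst ` M s"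
      have "rainbow A (insert (x, m s) (M s))"
        using Ms c x(4) by (intro rainbow_insert) auto
      moreover have "insert (x, m s) (M s) \<subseteq> R \<times> B" using Ms(2) x(1) mB[OF s] by auto
      moreover have "(x, m s) \<notin> M s" using c by force
      then have "card (insert (x, m s) (M s)) = Suc (card T)" using finM Ms(3) by simp
      ultimately show False using maximal[of "insert (x, m s) (M s)"] unfolding P_def by simp
    qed
    then obtain q where q: "(x, q) \<in> M s" by force
    \<comment> \<open>The cell of \<open>T\<close> in a later column \<open>m t\<close> is still in
      \<open>M s\<close>. So \<open>q = m t\<close> would force \<open>x = \<rho> t\<close>, a row
      that is excluded here.\<close>
    have "q \<noteq> m t" if t: "t \<in> {s<..h}" for t
    proof
      assume qt: "q = m t"
      have t1: "t \<in> {1..h}" using t by auto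
      have "m t \<noteq> m a" if "a \<in> {1..s}" for a
        using inj_onD[OF inj_m, of t a] that t s by auto
      then have "m t \<notin> m ` {1..s}" by blast
      then have "(\<rho> t, m t) \<in> M s" using keep[OF \<rho>T[OF t1]] by simp
      then have "x = \<rho> t" using rainbow_sndD[OF Ms(1) q] qt by metis
      then show False using x(2) t by blast
    qed
    moreover have "A (\<rho> s) q \<in> ?Sy \<or> A (\<rho> s) q = A x (m s)"
    proof (rule ccontr)
      assume c: "\<not> ?thesis"
      have free: "A (\<rho> s) q \<notin> ?Sy" and ne: "A x (m s) \<noteq> A (\<rho> s) q" using c by metis+
      have "case_prod A ` (M s - {(x, q)}) \<subseteq> ?Sy" unfolding Ms(4)[symmetric] by (rule image_mono) blast
      then have ab: "A x (m s) \<notin> case_prod A ` (M s - {(x, q)})"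
        "A (\<rho> s) q \<notin> case_prod A ` (M s - {(x, q)})"
        using x(4) free by (meson subsetD)+
      have "insert (\<rho> s, q) (insert (x, m s) (M s - {(x, q)})) \<subseteq> R \<times> B"
        using Ms(2) q \<rho>(1)[OF s] mB[OF s] x(1) by blast
      then show False
        using rainbow_swap[OF Ms(1) q \<rho>(2)[OF s] Ms(5) ab ne finM] Ms(3)
          maximal[of "insert (\<rho> s, q) (insert (x, m s) (M s - {(x, q)}))"]
        unfolding P_def by simp
    qed
    ultimately show "\<exists>q. (x, q) \<in> M s \<and> q \<notin> m ` {s<..h} \<and> (A (\<rho> s) q \<in> ?Sy \<or> A (\<rho> s) q = A x (m s))"
      using q by blast
  qed (use fin T_RK rain inj_m \<rho>T in auto)
  then have "2 * card (case_prod A ` (R \<times> K)) + 2 * (h + 1) * n \<le> 2 * n * n + h * (h + 1) + 2 * h"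
    unfolding card_R card_K .
  moreover have "(3 - sqrt 5) / 2 * real n + (sqrt 5 - 1) / 4 \<le> real h"
  proof -
    have "sqrt 5 \<le> 3" by (rule real_le_lsqrt) auto
    then have "(sqrt 5 - 1) / 4 \<le> 1" by simp
    moreover have "real (card singleton_cols) + 1 \<le> real h" using h_ge by linarith
    ultimately show ?thesis using card_singleton_columns unfolding singleton_cols_def
      by (smt (verit, best))
  qed
  ultimately show False using numeric_contradiction[OF many] h_n by blast
qed

text \<open>The singleton makes its own row blocked with column \<open>j\<close>, which supplies
  many exclusive symbols in that column. If another row \<open>i\<close> were not blocked with
  \<open>j\<close>, a partial transversal of size \<open>n - 1\<close> missing \<open>i\<close> and
  \<open>j\<close> would exist, which \<open>exclusive_column_false\<close> forbids.\<close>

lemma no_counterexample: False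
proof (rule all_blocked_false)
  fix i j assume i: "i \<in> R" and j: "j \<in> singleton_cols"
  obtain x where x: "singleton x j" using j unfolding singleton_cols_def by blast
  then have xj: "x \<in> R" "j \<in> K" unfolding singleton_def by auto
  show "blocked i j"
  proof (rule ccontr)
    assume "\<not> blocked i j"
    then obtain T where "T \<subseteq> (R - {i}) \<times> (K - {j})" "rainbow A T" "card T = n - 1"
      unfolding blocked_def by blast
    then show False
      using exclusive_column_false[OF i xj(2)] card_exclusive[OF xj singleton_blocked[OF x]] by blast
  qed
qed

end

section \<open>Row-Latin arrays\<close>

text \<open>The induction varies the row and column sets of one fixed array, so the array left after
  a deletion is an instance of the induction hypothesis, which yields \<open>minor\<close>. Order 1
  is treated apart because the locale requires order at least 2.\<close>

theorem row_latin_rainbow: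
  fixes A :: "'r \<Rightarrow> 'k \<Rightarrow> 'a"
  assumes "finite R" "finite K" "card R = n" "card K = n" "\<And>i. i \<in> R \<Longrightarrow> inj_on (A i) K"
    and "(5 - sqrt 5) / 4 * real n ^ 2 \<le> real (card (case_prod A ` (R \<times> K)))"
  shows "\<exists>T. T \<subseteq> R \<times> K \<and> rainbow A T \<and> card T = n"
  using assms
proof (induction n arbitrary: R K)
  case 0
  have "rainbow A {}" unfolding rainbow_def by simp
  then show ?case by force
next
  case (Suc n)
  show ?case
  proof (cases "n = 0")
    case True
    then obtain i j where "R = {i}" "K = {j}" using Suc.prems(3,4) card_1_singletonE by (metis One_nat_def)
    moreover have "rainbow A {(i, j)}" unfolding rainbow_def by simp
    ultimately have "{(i, j)} \<subseteq> R \<times> K \<and> rainbow A {(i, j)} \<and> card {(i, j)} = Suc n" using True by simp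
    then show ?thesis by blast
  next
    case False
    show ?thesis
    proof (rule ccontr)
      assume none: "\<not> ?thesis"
      have "counterexample R K A (Suc n)"
      proof
        fix i j assume ij: "i \<in> R" "j \<in> K"
          and no: "\<And>T. T \<subseteq> (R - {i}) \<times> (K - {j}) \<Longrightarrow> rainbow A T \<Longrightarrow> card T \<noteq> Suc n - 1"
        have row': "inj_on (A x) (K - {j})" if "x \<in> R - {i}" for x
          using Suc.prems(5)[of x] that by (auto intro: inj_on_subset)
        show "real (card (case_prod A ` ((R - {i}) \<times> (K - {j})))) < (5 - sqrt 5) / 4 * real (Suc n - 1) ^ 2"
        proof (rule ccontr)
          assume "\<not> ?thesis"
          then have "(5 - sqrt 5) / 4 * real n ^ 2 \<le> real (card (case_prod A ` ((R - {i}) \<times> (K - {j}))))"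
            by simp
          then show False
            using Suc.IH[of "R - {i}" "K - {j}"] row' Suc.prems(1-4) ij no by auto
        qed
      qed (use Suc.prems none False in auto)
      then show False by (rule counterexample.no_counterexample)
    qed
  qed
qed

lemma row_latin_transversal:
  assumes "row_latin n A" "(5 - sqrt 5) / 4 * real n ^ 2 \<le> real (card (symbols n A))"
  shows "has_transversal n A"
proof -
  have "symbols n A = case_prod A ` ({..<n} \<times> {..<n})" unfolding symbols_def by force
  then obtain T where "T \<subseteq> {..<n} \<times> {..<n}" "rainbow A T" "card T = n"
    using row_latin_rainbow[of "{..<n}" "{..<n}" n A] assms unfolding row_latin_def by auto
  then show ?thesis unfolding has_transversal_def is_transversal_def rainbow_def by blast
qed

theorem mainTheorem9:
  shows "(\<forall>(n::nat) (A :: nat \<Rightarrow> nat \<Rightarrow> 'a).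
            row_latin n A \<and> (5 - sqrt 5) / 4 * real n ^ 2 \<le> real (card (symbols n A))
            \<longrightarrow> has_transversal n A)
       \<and> (\<forall>n::nat. 1 < n \<longrightarrow> l_r n \<le> nat \<lceil>(5 - sqrt 5) / 4 * real n ^ 2\<rceil>)"
proof (intro conjI allI impI)
  fix n :: nat and A :: "nat \<Rightarrow> nat \<Rightarrow> 'a"
  assume "row_latin n A \<and> (5 - sqrt 5) / 4 * real n ^ 2 \<le> real (card (symbols n A))"
  then show "has_transversal n A" using row_latin_transversal by blast
next
  fix n :: nat assume n: "1 < n"
  let ?x = "(5 - sqrt 5) / 4 * real n ^ 2"
  \<comment> \<open>This gives a coefficient of at least 1/2, so for \<open>n\<close> at least 2 the
    bound is at least \<open>n\<close>, as the definition of \<open>l_r\<close> demands.\<close>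
  have "sqrt 5 \<le> 3" by (rule real_le_lsqrt) auto
  then have "1 / 2 * (real n * real n) \<le> (5 - sqrt 5) / 4 * (real n * real n)"
    by (intro mult_right_mono) auto
  moreover have "2 * real n \<le> real n * real n" using n by (intro mult_right_mono) auto
  ultimately have "real n \<le> ?x" unfolding power2_eq_square by linarith
  then have le: "n \<le> nat \<lceil>?x\<rceil>" by linarith
  show "l_r n \<le> nat \<lceil>?x\<rceil>"
    unfolding l_r_def
  proof (rule Least_le, intro conjI allI impI)
    show "0 < nat \<lceil>?x\<rceil>" "n \<le> nat \<lceil>?x\<rceil>" using le n by linarith+
    fix A :: "nat \<Rightarrow> nat \<Rightarrow> nat"
    assume A: "row_latin n A \<and> nat \<lceil>?x\<rceil> \<le> card (symbols n A)"
    then have "?x \<le> real (card (symbols n A))" by linarith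
    then show "has_transversal n A" using A row_latin_transversal by blast
  qed
qed

end
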